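(* Let $\alpha\in(0,1)$. Let $g:(0,\infty)\to\mathbb{R}$ be such that $g$ and $y\mapsto y\,g(y)$ belong to $L^1(0,\infty)$ and have compact support, let $\theta\in(0,1)$ be any fixed number, and let $m=\int_0^\infty g(y)\,dy$. For $x>0$, $t>0$ define $$w_1(x,t)=\int_0^\infty\big(\mathscr{E}_t(x-y)-\mathscr{E}_t(x+y)\big)g(y)\,dy,\qquad w_2(x,t)=\int_0^\infty\big(\mathscr{E}_t(x-y)+\mathscr{E}_t(x+y)\big)g(y)\,dy,$$ where $\mathscr{E}_t$ is the (evenly extended) fundamental solution given in the context. Then: (a) there is a constant $K_1>0$ such that $$\|w_1(\cdot,t)\|_{L^{1/(1-\theta)}}\le K_1\,t^{-(1+\theta)/(1+\alpha)}\,\|y\,g(\cdot)\|_{L^1}\qquad\text{for all } t>1;$$ (b) there is a constant $K_2>0$ such that $$\|w_2(\cdot,t)-2m\,\mathscr{E}_t(\cdot)\|_{L^{1/(1-\theta)}}\le K_2\,t^{-(1+\theta)/(1+\alpha)}\,\|y\,g(\cdot)\|_{L^1}\qquad\text{for all } t>1;$$ (c) with the explicit constant $C_2(\alpha)$ given in the context, for all $t>1$, $$\|w_2(\cdot,t)-2m\,\mathscr{E}_t(\cdot)\|_{L^\infty}\le \frac{C_2(\alpha)}{t^{2/(1+\alpha)}}\|y\,g(\cdot)\|_{L^1}\quad\text{and}\quad \|w_1(\cdot,t)\|_{L^\infty}\le \frac{C_2(\alpha)}{t^{2/(1+\alpha)}}\|y\,g(\cdot)\|_{L^1}.$$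
   Context: All $L^p$ norms are over $(0,\infty)$ with Lebesgue measure (in the space variable), and $\|y\,g(\cdot)\|_{L^1}=\int_0^\infty y|g(y)|\,dy$. For $\alpha\in(0,1)$ let $$E_{\alpha,1+1/\alpha,1/\alpha}(z)=\sum_{n=0}^\infty b_n z^n,\qquad b_0=1,\quad b_n=\prod_{i=0}^{n-1}\frac{\Gamma(\alpha i+i+2)}{\Gamma(\alpha(i+1)+i+2)}\ (n>0),$$ an entire function (a three-parameter Mittag-Leffler function). The profile function is $\Phi(x)=E_{\alpha,1+1/\alpha,1/\alpha}\left(-\frac{x^{1+\alpha}}{1+\alpha}\right)$ for $x\ge 0$. The constant $a_0$ is defined by $\frac1{a_0}=2\int_0^\infty \Phi(x)\,dx$ (this integral is known to be finite and positive). For $t>0$ and $x\in\mathbb{R}$, $$\mathscr{E}_t(x)=a_0\,t^{-\frac1{1+\alpha}}\,\Phi\left(\frac{|x|}{t^{1/(1+\alpha)}}\right).$$ (This is the self-similar solution of $u_t-\partial_x D^\alpha_{xC}u=0$ on $(0,\infty)^2$, where $D^\alpha_{xC}$ is the Caputo derivative of order $\alpha$ in $x$ based at $0$, extended evenly in $x$.) Constants: $$C_1(\alpha)=\alpha\,2^{1+\alpha}\max\left\{\int_{1/2}^1\frac{du}{u^{1+\alpha}(1-u)^{1-\alpha}},\,2\right\},\qquad C_2(\alpha)=2a_0\,C_1(\alpha).$$ *)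

theory Defs
  imports "HOL-Analysis.Analysis" "HOL-Probability.Essential_Supremum"
begin

abbreviation half_line :: "real measure" where
  "half_line \<equiv> lebesgue_on {0<..}"

text \<open>Norms take extended values, so that a bound by a finite number includes membership in the
  corresponding space. As with \<^const>\<open>esssup\<close>, a function that is not measurable gets the
  value \<open>\<infinity>\<close>. The exponent \<open>p\<close> is meant to satisfy \<open>1 \<le> p < \<infinity>\<close>.\<close>

definition Lp_norm :: "real \<Rightarrow> (real \<Rightarrow> real) \<Rightarrow> ennreal" where
  "Lp_norm p f =
     (if f \<in> borel_measurable half_line \<and> integrable half_line (\<lambda>x. \<bar>f x\<bar> powr p)
      then ennreal ((LINT x|half_line. \<bar>f x\<bar> powr p) powr (1 / p)) else \<infinity>)"

definition Linf_norm :: "(real \<Rightarrow> real) \<Rightarrow> ennreal" where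
  "Linf_norm f =
     (if f \<in> borel_measurable half_line then esssup half_line (\<lambda>x. ennreal \<bar>f x\<bar>) else \<infinity>)"

text \<open>Elements of \<open>L\<^sup>1(0,\<infinity>)\<close> are only determined almost everywhere, hence so is their support;
  it has to be compact as a subset of the open half-line.\<close>

definition compactly_supported :: "(real \<Rightarrow> real) \<Rightarrow> bool" where
  "compactly_supported f \<longleftrightarrow>
     (\<exists>K. compact K \<and> K \<subseteq> {0<..} \<and> (AE y in half_line. y \<notin> K \<longrightarrow> f y = 0))"

definition ml_coeff :: "real \<Rightarrow> nat \<Rightarrow> real" where
  "ml_coeff \<alpha> n =
     (\<Prod>i<n. Gamma (\<alpha> * real i + real i + 2) / Gamma (\<alpha> * (real i + 1) + real i + 2))"

text \<open>The three-parameter Mittag-Leffler function \<open>E\<close> with parameters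
  \<open>\<alpha>\<close>, \<open>1 + 1/\<alpha>\<close>, \<open>1/\<alpha>\<close>.\<close>

definition mittag_leffler3 :: "real \<Rightarrow> 'a::{real_normed_algebra_1, banach} \<Rightarrow> 'a" where
  "mittag_leffler3 \<alpha> z = (\<Sum>n. ml_coeff \<alpha> n *\<^sub>R z ^ n)"

definition profile :: "real \<Rightarrow> real \<Rightarrow> real" where
  "profile \<alpha> x = mittag_leffler3 \<alpha> (- (x powr (1 + \<alpha>) / (1 + \<alpha>)))"

definition a0 :: "real \<Rightarrow> real" where
  "a0 \<alpha> = 1 / (2 * (LINT x|half_line. profile \<alpha> x))"

definition fund_sol :: "real \<Rightarrow> real \<Rightarrow> real \<Rightarrow> real" where
  "fund_sol \<alpha> t x =
     a0 \<alpha> * t powr (- 1 / (1 + \<alpha>)) * profile \<alpha> (\<bar>x\<bar> / t powr (1 / (1 + \<alpha>)))"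

definition C1 :: "real \<Rightarrow> real" where
  "C1 \<alpha> = \<alpha> * 2 powr (1 + \<alpha>) *
     max (LBINT u:{1/2..1}. 1 / (u powr (1 + \<alpha>) * (1 - u) powr (1 - \<alpha>))) 2"

definition C2 :: "real \<Rightarrow> real" where
  "C2 \<alpha> = 2 * a0 \<alpha> * C1 \<alpha>"

definition w1 :: "real \<Rightarrow> (real \<Rightarrow> real) \<Rightarrow> real \<Rightarrow> real \<Rightarrow> real" where
  "w1 \<alpha> g x t = (LINT y|half_line. (fund_sol \<alpha> t (x - y) - fund_sol \<alpha> t (x + y)) * g y)"

definition w2 :: "real \<Rightarrow> (real \<Rightarrow> real) \<Rightarrow> real \<Rightarrow> real \<Rightarrow> real" where
  "w2 \<alpha> g x t = (LINT y|half_line. (fund_sol \<alpha> t (x - y) + fund_sol \<alpha> t (x + y)) * g y)"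

end

theory Submission
  imports Defs "HOL-Real_Asymp.Real_Asymp"
begin

text \<open>
  The profile solves the fractional equation \<open>D\<^sup>\<alpha> \<Phi> = - x \<Phi> / (1 + \<alpha>)\<close> with the Caputo
  derivative, whose maximum principle (a negative minimum over \<open>[0, z]\<close> attained at \<open>z\<close> has a
  negative Caputo derivative) gives \<open>\<Phi> \<ge> 0\<close>; applied to \<open>\<Phi>(x) - \<Phi>(\<lambda> x)\<close>, it gives that \<open>\<Phi>\<close>
  decreases. In the Volterra equation for \<open>-\<Phi>'\<close> one may therefore drop the \<open>s \<Phi>'\<close> term and
  estimate \<open>\<Phi>(s) \<le> s \<Phi>(s) + 1\<close> for \<open>s \<le> 1\<close> and \<open>\<Phi>(s) \<le> s \<Phi>(s)\<close> for \<open>s \<ge> 1\<close>, which yields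
  \<open>\<bar>\<Phi>'\<bar> \<le> 2 \<le> C\<^sub>1(\<alpha>)\<close>.

  The kernels of \<open>w\<^sub>1\<close> and \<open>w\<^sub>2 - 2 m E\<^sub>t\<close> are both dominated by
  \<open>\<bar>E\<^sub>t(x - y) - E\<^sub>t(x)\<bar> + \<bar>E\<^sub>t(x + y) - E\<^sub>t(x)\<bar>\<close>. The Lipschitz bound controls its supremum in
  \<open>x\<close>, monotonicity its integral in \<open>x\<close> (by telescoping), each by a multiple of \<open>y\<close>. The
  \<open>L\<^sup>p\<close> bounds follow by interpolating between \<open>L\<^sup>1\<close> and \<open>L\<^sup>\<infinity>\<close>.
\<close>

subsection \<open>Maximum principle and fractional integrals of power series\<close>

text \<open>Otherwise \<open>W\<close> has a negative minimum over \<open>{0..x}\<close>, attained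
  at some \<open>z > 0\<close>. Integration by parts bounds the integral in \<open>caputo\<close> at
  \<open>z\<close> by \<open>- G 0 = - (W 0 - W z) * z powr (- \<alpha>)\<close>, which is negative
  because \<open>W 0 \<ge> 0 > W z\<close>.\<close>

lemma caputo_comparison:
  fixes W W' :: "real \<Rightarrow> real"
  assumes \<alpha>: "0 < \<alpha>" "\<alpha> < 1"
    and cont: "continuous_on {0..} W"
    and deriv: "\<And>x. x > 0 \<Longrightarrow> (W has_real_derivative W' x) (at x)"
    and W0: "W 0 \<ge> 0"
    and caputo: "\<And>x. x > 0 \<Longrightarrow> W x < 0 \<Longrightarrow>
      \<exists>I\<ge>0. ((\<lambda>s. W' s * (x - s) powr (- \<alpha>)) has_integral I) {0..x}"
    and x: "x \<ge> 0"
  shows "W x \<ge> 0"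
proof (rule ccontr)
  assume neg: "\<not> W x \<ge> 0"
  have "continuous_on {0..x} W" using cont by (rule continuous_on_subset) auto
  then obtain z where z: "z \<in> {0..x}" and min: "\<And>s. s \<in> {0..x} \<Longrightarrow> W z \<le> W s"
    using continuous_attains_inf[of "{0..x}" W] x by auto
  have Wz: "W z < 0" using min[of x] x neg by auto
  have z0: "z > 0" using z Wz W0 by (cases "z = 0") auto
  obtain I where I: "I \<ge> 0" "((\<lambda>s. W' s * (z - s) powr (- \<alpha>)) has_integral I) {0..z}"
    using caputo[OF z0 Wz] by auto
  \<comment> \<open>Integration by parts: \<open>W' s * (z - s) powr (- \<alpha>)\<close> differs from \<open>G'\<close> by a term that has a sign
    because \<open>z\<close> is a minimum.\<close>
  define G where "G s = (W s - W z) * (z - s) powr (- \<alpha>)" for s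
  define G' where
    "G' s = W' s * (z - s) powr (- \<alpha>) + (W s - W z) * (\<alpha> * (z - s) powr (- \<alpha> - 1))" for s
  have dG: "(G has_real_derivative G' s) (at s)" if "s \<in> {0<..<z}" for s
    unfolding G_def G'_def using that
    by (auto intro!: derivative_eq_intros deriv)
  have "continuous_on {0..z} G"
    unfolding continuous_on_eq_continuous_within
  proof
    fix s assume s: "s \<in> {0..z}"
    show "continuous (at s within {0..z}) G"
    proof (cases "s = z")
      case False
      have "continuous (at s within {0..z}) W"
        using cont s by (auto simp: continuous_on_eq_continuous_within intro: continuous_within_subset)
      then show ?thesis unfolding G_def using s False
        by (intro continuous_intros) auto
    next
      case True
      \<comment> \<open>At the singular endpoint \<open>G\<close> is a difference quotient of
        \<open>W\<close> times \<open>- (z - s) powr (1 - \<alpha>)\<close>. The second factor tends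
        to 0 because \<open>\<alpha> < 1\<close>, in agreement with \<open>G z = 0\<close>.\<close>
      have "((\<lambda>s. (W s - W z) / (s - z)) \<longlongrightarrow> W' z) (at z within {0..z})"
        using deriv[OF z0] has_field_derivative_at_within[of W "W' z" z "{0..z}"]
        by (simp add: has_field_derivative_iff)
      moreover have "((\<lambda>s. - ((z - s) powr (1 - \<alpha>))) \<longlongrightarrow> 0) (at z within {0..z})"
      proof -
        have "((\<lambda>s. - ((z - s) powr (1 - \<alpha>))) \<longlongrightarrow> - ((z - z) powr (1 - \<alpha>))) (at z within {0..z})"
          using \<alpha> by (intro tendsto_minus tendsto_powr2 tendsto_intros)
             (auto simp: eventually_at_filter)
        then show ?thesis by simp
      qed
      ultimately have "((\<lambda>s. (W s - W z) / (s - z) * - ((z - s) powr (1 - \<alpha>))) \<longlongrightarrow> W' z * 0)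
          (at z within {0..z})" by (rule tendsto_mult)
      moreover have "eventually (\<lambda>s. (W s - W z) / (s - z) * - ((z - s) powr (1 - \<alpha>)) = G s)
          (at z within {0..z})"
        unfolding eventually_at_filter G_def
        by (auto simp: powr_diff powr_minus field_simps intro!: always_eventually)
      ultimately have "(G \<longlongrightarrow> 0) (at z within {0..z})"
        using tendsto_cong by fastforce
      then show ?thesis using True by (simp add: continuous_within G_def)
    qed
  qed
  then have "(G' has_integral (G z - G 0)) {0..z}"
    using z0 dG by (intro fundamental_theorem_of_calculus_interior)
      (auto simp: has_real_derivative_iff_has_vector_derivative)
  moreover have "W' s * (z - s) powr (- \<alpha>) \<le> G' s" if "s \<in> {0..z}" for s
    unfolding G'_def using min[of s] that z \<alpha> by simp
  ultimately have "I \<le> G z - G 0"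
    using has_integral_le[OF I(2)] by blast
  also have "\<dots> < 0" using z0 Wz W0 unfolding G_def by simp
  finally show False using I(1) by simp
qed

lemma has_integral_Beta_scaled:
  fixes p \<beta> x :: real
  assumes "p > 0" "\<beta> > 0" "x > 0"
  shows "((\<lambda>s. s powr (p - 1) * (x - s) powr (\<beta> - 1)) has_integral
    Beta p \<beta> * x powr (p + \<beta> - 1)) {0..x}"
proof -
  have "((\<lambda>s. (s / x) powr (p - 1) * (1 - s / x) powr (\<beta> - 1)) has_integral Beta p \<beta> * x) {0..x}"
    using has_integral_affinity'[of _ _ 0 "1::real" "1 / x" 0, OF has_integral_Beta_real[of p \<beta>, unfolded cbox_interval[symmetric]]] assms
    by (simp add: field_simps)
  from has_integral_mult_right[OF this, of "x powr (p - 1) * x powr (\<beta> - 1)"]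
  have "((\<lambda>s. x powr (p - 1) * x powr (\<beta> - 1) * ((s / x) powr (p - 1) * (1 - s / x) powr (\<beta> - 1)))
     has_integral Beta p \<beta> * x powr (p + \<beta> - 1)) {0..x}" 
    using assms by (simp add: powr_diff powr_add field_simps)
  then show ?thesis
  proof (rule has_integral_eq[rotated])
    fix s assume s: "s \<in> {0..x}"
    have "x powr (p - 1) * (s / x) powr (p - 1) = s powr (p - 1)"
      using s assms by (simp flip: powr_mult)
    moreover have "x powr (\<beta> - 1) * (1 - s / x) powr (\<beta> - 1) = (x - s) powr (\<beta> - 1)"
    proof -
      have "x * (1 - s / x) = x - s" using assms by (simp add: right_diff_distrib)
      then show ?thesis using s assms by (simp flip: powr_mult)
    qed
    ultimately show "x powr (p - 1) * x powr (\<beta> - 1) * ((s / x) powr (p - 1) * (1 - s / x) powr (\<beta> - 1))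
      = s powr (p - 1) * (x - s) powr (\<beta> - 1)" by (metis mult.assoc mult.left_commute)
  qed
qed

text \<open>Termwise integration, each term being a scaled Beta integral. The common lower bound
  \<open>\<delta>\<close> of the exponents controls the integrated series:
  \<open>Beta (p n) \<beta> \<le> Beta \<delta> \<beta>\<close> reduces its absolute convergence to
  that of the given series at \<open>x\<close>.\<close>

lemma fractional_integral_series:
  fixes a p :: "nat \<Rightarrow> real"
  assumes \<beta>: "\<beta> > 0" and \<delta>: "\<delta> > 0" "\<And>n. \<delta> \<le> p n" and x: "x > 0"
    and summ: "\<And>s. s > 0 \<Longrightarrow> summable (\<lambda>n. \<bar>a n\<bar> * s powr (p n - 1))"
  shows "((\<lambda>s. (\<Sum>n. a n * s powr (p n - 1)) * (x - s) powr (\<beta> - 1)) has_integral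
      (\<Sum>n. a n * Beta (p n) \<beta> * x powr (p n + \<beta> - 1))) {0..x}"
proof -
  have p: "p n > 0" for n using \<delta>(2)[of n] \<delta>(1) by simp
  define k where "k n s = s powr (p n - 1) * (x - s) powr (\<beta> - 1)" for n s
  define f where "f n s = indicat_real {0..x} s *\<^sub>R (a n * k n s)" for n s
  have hi: "(k n has_integral Beta (p n) \<beta> * x powr (p n + \<beta> - 1)) {0..x}" for n
    unfolding k_def using has_integral_Beta_scaled p \<beta> x by blast
  have k0: "k n s \<ge> 0" for n s by (simp add: k_def)
  have "k n absolutely_integrable_on {0..x}" for n
    using hi[of n] k0 by (intro nonnegative_absolutely_integrable_1) auto
  then have set_int: "set_integrable lebesgue {0..x} (\<lambda>s. d * k n s)" for n d
    by (rule set_integrable_mult_right)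
  have int: "integrable lebesgue (f n)" for n
    using set_int[of "a n" n] unfolding f_def set_integrable_def .
  have val: "(LINT s:{0..x}|lebesgue. d * k n s) = d * (Beta (p n) \<beta> * x powr (p n + \<beta> - 1))" for n d
    using has_integral_unique[OF has_integral_set_lebesgue[OF set_int] has_integral_mult_right[OF hi]] .
  have sums1: "summable (\<lambda>n. norm (f n s))" for s
  proof (cases "0 < s \<and> s \<le> x")
    case True
    then have "norm (f n s) = \<bar>a n\<bar> * s powr (p n - 1) * (x - s) powr (\<beta> - 1)" for n
      by (auto simp: f_def k_def abs_mult)
    then show ?thesis using summable_mult2[OF summ, of s] True by simp
  next
    case False
    \<comment> \<open>At \<open>s = 0\<close> the terms vanish whatever the exponent is, since
      \<open>0 powr r = 0\<close> for every \<open>r\<close>.\<close>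
    then have "norm (f n s) = 0" for n by (cases "s = 0") (auto simp: f_def k_def)
    then show ?thesis by simp
  qed
  have norm_int: "(\<integral>s. norm (f n s) \<partial>lebesgue) = \<bar>a n\<bar> * (Beta (p n) \<beta> * x powr (p n + \<beta> - 1))" for n
  proof -
    have "(\<lambda>s. norm (f n s)) = (\<lambda>s. indicat_real {0..x} s *\<^sub>R (\<bar>a n\<bar> * k n s))"
      using k0 by (auto simp: f_def abs_mult)
    then show ?thesis using val[of "\<bar>a n\<bar>" n] unfolding set_lebesgue_integral_def by (simp only:)
  qed
  have sums2: "summable (\<lambda>n. \<integral>s. norm (f n s) \<partial>lebesgue)"
  proof (rule summable_comparison_test')
    show "summable (\<lambda>n. Beta \<delta> \<beta> * x powr \<beta> * (\<bar>a n\<bar> * x powr (p n - 1)))"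
      by (intro summable_mult summ x)
    fix n
    have "Beta (p n) \<beta> \<le> Beta \<delta> \<beta>" using \<beta> \<delta> by (intro Beta_real_mono) auto
    moreover have "0 \<le> Beta (p n) \<beta>" using Gamma_real_pos[OF \<beta>] Gamma_real_pos[OF p, of n] Gamma_real_pos[of "p n + \<beta>"] p[of n] \<beta>
      by (simp add: Beta_def)
    moreover have "x powr (p n + \<beta> - 1) = x powr \<beta> * x powr (p n - 1)"
      by (simp add: add.commute add_diff_eq flip: powr_add)
    ultimately show "norm (\<integral>s. norm (f n s) \<partial>lebesgue) \<le> Beta \<delta> \<beta> * x powr \<beta> * (\<bar>a n\<bar> * x powr (p n - 1))"
      unfolding norm_int using mult_right_mono[of "Beta (p n) \<beta>" "Beta \<delta> \<beta>" "x powr \<beta> * (\<bar>a n\<bar> * x powr (p n - 1))"]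
      by (simp add: abs_mult mult_ac)
  qed
  have AE1: "AE s in lebesgue. summable (\<lambda>n. norm (f n s))" using sums1 by simp
  have "integrable lebesgue (\<lambda>s. \<Sum>n. f n s)"
    by (rule integrable_suminf[OF int AE1 sums2])
  then have "((\<lambda>s. \<Sum>n. f n s) has_integral (\<integral>s. (\<Sum>n. f n s) \<partial>lebesgue)) UNIV"
    by (rule has_integral_integral_lebesgue)
  also have "(\<integral>s. (\<Sum>n. f n s) \<partial>lebesgue) = (\<Sum>n. integral\<^sup>L lebesgue (f n))"
    by (rule integral_suminf[OF int AE1 sums2])
  also have "(\<lambda>n. integral\<^sup>L lebesgue (f n)) = (\<lambda>n. a n * Beta (p n) \<beta> * x powr (p n + \<beta> - 1))"
    using val unfolding f_def[abs_def] set_lebesgue_integral_def mult.assoc by simp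
  also have "(\<lambda>s. \<Sum>n. f n s) =
      (\<lambda>s. if s \<in> {0..x} then (\<Sum>n. a n * s powr (p n - 1)) * (x - s) powr (\<beta> - 1) else 0)"
  proof
    fix s
    consider "s = 0" | "0 < s" "s \<le> x" | "s \<notin> {0..x}" by force
    then show "(\<Sum>n. f n s) = (if s \<in> {0..x} then (\<Sum>n. a n * s powr (p n - 1)) * (x - s) powr (\<beta> - 1) else 0)"
    proof cases
      case 2
      have "summable (\<lambda>n. norm (a n * s powr (p n - 1)))" using summ[OF 2(1)] by (simp add: abs_mult)
      then have "summable (\<lambda>n. a n * s powr (p n - 1))" by (rule summable_norm_cancel)
      from suminf_mult2[OF this, of "(x - s) powr (\<beta> - 1)"] show ?thesis
        using 2 by (simp add: f_def k_def mult.assoc)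
    qed (auto simp: f_def k_def)
  qed
  finally show ?thesis by (simp only: has_integral_restrict_UNIV)
qed

lemma power_eq_powr_mult:
  fixes x :: real
  assumes "x > 0"
  shows "(x powr r) ^ n = x powr (r * real n)"
  using assms by (simp add: powr_powr flip: powr_realpow)

section \<open>Inequalities for the Gamma function from log-convexity\<close>

text \<open>The convex function \<open>ln \<circ> Gamma\<close> vanishes at 1 and at 2, so it cannot
  be negative to the right of 2. The weight \<open>t\<close> writes 2 as a convex combination of 1
  and \<open>x\<close>.\<close>

lemma Gamma_ge_1: "1 \<le> Gamma (x::real)" if "2 \<le> x"
proof (cases "x = 2")
  case False
  have G2: "Gamma (2::real) = 1" using Gamma_numeral[of "num.Bit0 num.One"] by simp
  define t where "t = 1 / (x - 1)"
  have t: "0 < t" "t \<le> 1" using that by (auto simp: t_def)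
  have "t * (x - 1) = 1" using that by (simp add: t_def)
  then have "(1 - t) *\<^sub>R 1 + t *\<^sub>R x = 2" by (simp add: algebra_simps)
  moreover have "(ln \<circ> Gamma) ((1 - t) *\<^sub>R 1 + t *\<^sub>R x) \<le> (1 - t) * (ln \<circ> Gamma) 1 + t * (ln \<circ> Gamma) x"
    using t that by (intro convex_onD[OF log_convex_Gamma_real]) auto
  ultimately have "ln (Gamma (2::real)) \<le> t * ln (Gamma x)" by (simp only: o_def) simp
  then have "0 \<le> ln (Gamma x)" using t G2 by (simp add: zero_le_mult_iff)
  then show ?thesis using Gamma_real_pos[of x] that by simp
next
  case True
  have "Gamma (2::real) = 1" using Gamma_numeral[of "num.Bit0 num.One"] by simp
  then show ?thesis using True by simp
qed

text \<open>Wendel's inequality \<open>Gamma (u + s) \<le> u powr s * Gamma u\<close> with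
  \<open>u = p + \<alpha>\<close> and \<open>s = 1 - \<alpha>\<close>, obtained from log-convexity
  between \<open>u\<close> and \<open>u + 1\<close>. The bound decays like
  \<open>p powr (- \<alpha>)\<close>, which suffices for a ratio test.\<close>

lemma Gamma_ratio_le:
  fixes p \<alpha> :: real
  assumes "p > 0" "0 < \<alpha>" "\<alpha> < 1"
  shows "Gamma p / Gamma (p + \<alpha>) \<le> (p + \<alpha>) powr (1 - \<alpha>) / p"
proof -
  have pos: "Gamma (p + \<alpha>) > 0" "Gamma p > 0" "Gamma (p + 1) > 0" using assms by (auto intro!: Gamma_real_pos)
  have "(1 - (1 - \<alpha>)) *\<^sub>R (p + \<alpha>) + (1 - \<alpha>) *\<^sub>R (p + \<alpha> + 1) = p + 1"
    by (simp add: algebra_simps)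
  with convex_onD[OF log_convex_Gamma_real, of "1 - \<alpha>" "p + \<alpha>" "p + \<alpha> + 1"] assms
  have "ln (Gamma (p + 1)) \<le> \<alpha> * ln (Gamma (p + \<alpha>)) + (1 - \<alpha>) * ln (Gamma (p + \<alpha> + 1))" by simp
  also have "Gamma (p + \<alpha> + 1) = (p + \<alpha>) * Gamma (p + \<alpha>)"
    using assms by (intro Gamma_plus1) (auto elim!: nonpos_Ints_cases)
  also have "ln ((p + \<alpha>) * Gamma (p + \<alpha>)) = ln (p + \<alpha>) + ln (Gamma (p + \<alpha>))"
    using pos(1) assms by (simp add: ln_mult_pos)
  finally have "ln (Gamma (p + 1)) \<le> ln ((p + \<alpha>) powr (1 - \<alpha>) * Gamma (p + \<alpha>))"
    using pos assms by (simp add: ln_mult_pos ln_powr algebra_simps)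
  then have "Gamma (p + 1) \<le> (p + \<alpha>) powr (1 - \<alpha>) * Gamma (p + \<alpha>)"
    using pos assms by simp
  moreover have "Gamma (p + 1) = p * Gamma p"
    using assms by (intro Gamma_plus1) (auto elim!: nonpos_Ints_cases)
  ultimately show ?thesis using pos assms by (simp add: field_simps)
qed

subsection \<open>The profile function\<close>

text \<open>The extra parameter turns dilations of the profile, \<open>\<Phi>(\<lambda> x)\<close>, into members of the same family:
  they correspond to \<open>c = \<lambda>\<^sup>1\<^sup>+\<^sup>\<alpha> / (1 + \<alpha>)\<close>. The derivative series is only valid for \<open>x > 0\<close>.\<close>

definition ml_profile :: "real \<Rightarrow> real \<Rightarrow> real \<Rightarrow> real" where
  "ml_profile \<alpha> c x = mittag_leffler3 \<alpha> (- (c * x powr (1 + \<alpha>)))"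

definition ml_profile_deriv :: "real \<Rightarrow> real \<Rightarrow> real \<Rightarrow> real" where
  "ml_profile_deriv \<alpha> c x = (\<Sum>n. ml_coeff \<alpha> (Suc n) * (- c) ^ Suc n * ((1 + \<alpha>) * Suc n) *
     x powr ((1 + \<alpha>) * Suc n - 1))"

context
  fixes \<alpha> :: real
  assumes \<alpha>: "0 < \<alpha>" "\<alpha> < 1"
begin

section \<open>Convergence of the Mittag-Leffler series\<close>

lemma ml_coeff_Suc:
  "ml_coeff \<alpha> (Suc n) = ml_coeff \<alpha> n * (Gamma ((1 + \<alpha>) * n + 2) / Gamma ((1 + \<alpha>) * n + 2 + \<alpha>))"
  by (simp add: ml_coeff_def algebra_simps)

lemma ml_coeff_pos: "ml_coeff \<alpha> n > 0"
  unfolding ml_coeff_def using \<alpha> by (intro prod_pos ballI divide_pos_pos Gamma_real_pos) (auto intro!: add_nonneg_pos)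

text \<open>Ratio test: by \<open>Gamma_ratio_le\<close> the quotient of consecutive coefficients
  tends to 0.\<close>

lemma summable_ml_coeff: "summable (\<lambda>n. ml_coeff \<alpha> n * z ^ n)" for z :: real
proof -
  have "((\<lambda>n::nat. ((1 + \<alpha>) * n + 2 + \<alpha>) powr (1 - \<alpha>) / ((1 + \<alpha>) * n + 2)) \<longlongrightarrow> 0) sequentially"
    using \<alpha> by real_asymp
  \<comment> \<open>This threshold bounds the ratio of consecutive terms by 1/2; the summand 1 keeps
    the denominator positive at \<open>z = 0\<close>.\<close>
  then have "eventually (\<lambda>n::nat. ((1 + \<alpha>) * n + 2 + \<alpha>) powr (1 - \<alpha>) / ((1 + \<alpha>) * n + 2) < 1 / (2 * (\<bar>z\<bar> + 1))) sequentially"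
    by (rule order_tendstoD) simp
  then obtain N where N: "\<And>n. n \<ge> N \<Longrightarrow> ((1 + \<alpha>) * real n + 2 + \<alpha>) powr (1 - \<alpha>) / ((1 + \<alpha>) * n + 2) < 1 / (2 * (\<bar>z\<bar> + 1))"
    by (auto simp: eventually_sequentially)
  show ?thesis
  proof (rule summable_ratio_test[of "1/2" N])
    fix n assume n: "n \<ge> N"
    define r where "r = Gamma ((1 + \<alpha>) * real n + 2) / Gamma ((1 + \<alpha>) * n + 2 + \<alpha>)"
    have "r \<le> 1 / (2 * (\<bar>z\<bar> + 1))" unfolding r_def
      using N[OF n] Gamma_ratio_le[of "(1 + \<alpha>) * real n + 2" \<alpha>] \<alpha> by (auto simp: add_nonneg_pos)
    moreover have r: "r > 0" unfolding r_def
      using \<alpha> by (intro divide_pos_pos Gamma_real_pos) (auto intro!: add_nonneg_pos)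
    ultimately have "\<bar>z\<bar> * r \<le> \<bar>z\<bar> * (1 / (2 * (\<bar>z\<bar> + 1)))" by (intro mult_left_mono) auto
    also have "\<dots> \<le> 1/2" by (simp add: field_simps)
    finally have zr: "\<bar>z\<bar> * r \<le> 1/2" .
    have "norm (ml_coeff \<alpha> (Suc n) * z ^ Suc n) = \<bar>z\<bar> * r * (ml_coeff \<alpha> n * \<bar>z\<bar> ^ n)"
      unfolding ml_coeff_Suc r_def[symmetric] using ml_coeff_pos[of n] r
      by (simp add: abs_mult power_abs)
    also have "\<dots> \<le> 1/2 * (ml_coeff \<alpha> n * \<bar>z\<bar> ^ n)"
      using zr ml_coeff_pos[of n] by (intro mult_right_mono) auto
    finally show "norm (ml_coeff \<alpha> (Suc n) * z ^ Suc n) \<le> 1/2 * norm (ml_coeff \<alpha> n * z ^ n)"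
      using ml_coeff_pos[of n] by (simp add: abs_mult power_abs)
  qed simp
qed

text \<open>A factor \<open>n\<close> turns the series into \<open>z\<close> times its derived
  series, which converges everywhere as well.\<close>

lemma summable_ml_coeff_linear: "summable (\<lambda>n. ml_coeff \<alpha> n * (A * real n + B) * z ^ n)" for z :: real
proof -
  have "summable (\<lambda>n. diffs (ml_coeff \<alpha>) n * z ^ n)"
    by (rule termdiff_converges_all) (rule summable_ml_coeff)
  then have "summable (\<lambda>n. z * (diffs (ml_coeff \<alpha>) n * z ^ n))" by (rule summable_mult)
  also have "(\<lambda>n. z * (diffs (ml_coeff \<alpha>) n * z ^ n)) =
      (\<lambda>n. ml_coeff \<alpha> (Suc n) * real (Suc n) * z ^ Suc n)"
    by (auto simp: diffs_def)
  finally have "summable (\<lambda>n. ml_coeff \<alpha> n * real n * z ^ n)"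
    by (subst (asm) summable_Suc_iff)
  from summable_add[OF summable_mult[OF this, of A] summable_mult[OF summable_ml_coeff[of z], of B]]
  show ?thesis by (simp add: algebra_simps)
qed

text \<open>The common source for the convergence of the series in powers of \<open>x\<close> below:
  \<open>A = 0\<close>, \<open>B = 1\<close> belongs to the profile, \<open>A = 1 + \<alpha>\<close>
  to the derivative of the profile or of \<open>x\<close> times the profile, and \<open>r\<close>
  shifts the exponents.\<close>

lemma summable_ml_profile_linear:
  assumes "s > 0"
  shows "summable (\<lambda>n. \<bar>ml_coeff \<alpha> n * (- c) ^ n * (A * real n + B)\<bar> * s powr ((1 + \<alpha>) * n + r))"
proof -
  have "summable (\<lambda>n. s powr r * (ml_coeff \<alpha> n * (\<bar>A\<bar> * real n + \<bar>B\<bar>) * (\<bar>c\<bar> * s powr (1 + \<alpha>)) ^ n))"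
    by (intro summable_mult summable_ml_coeff_linear)
  then show ?thesis
  proof (rule summable_comparison_test')
    fix n :: nat
    define S where "S = s powr ((1 + \<alpha>) * n)"
    have S0: "\<bar>S\<bar> = S" by (simp add: S_def)
    have "\<bar>A * real n + B\<bar> \<le> \<bar>A\<bar> * real n + \<bar>B\<bar>"
      using abs_triangle_ineq[of "A * real n" B] by (simp add: abs_mult)
    then have le: "ml_coeff \<alpha> n * \<bar>c\<bar> ^ n * (S * s powr r) * \<bar>A * real n + B\<bar> \<le>
        ml_coeff \<alpha> n * \<bar>c\<bar> ^ n * (S * s powr r) * (\<bar>A\<bar> * real n + \<bar>B\<bar>)"
      using ml_coeff_pos[of n] by (intro mult_left_mono) (auto simp: S_def)
    have "(\<bar>c\<bar> * s powr (1 + \<alpha>)) ^ n = \<bar>c\<bar> ^ n * S"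
      using assms by (simp only: power_mult_distrib power_eq_powr_mult S_def)
    moreover have "s powr ((1 + \<alpha>) * n + r) = S * s powr r" by (simp only: powr_add S_def)
    ultimately show "norm (\<bar>ml_coeff \<alpha> n * (- c) ^ n * (A * real n + B)\<bar> * s powr ((1 + \<alpha>) * n + r)) \<le>
      s powr r * (ml_coeff \<alpha> n * (\<bar>A\<bar> * real n + \<bar>B\<bar>) * (\<bar>c\<bar> * s powr (1 + \<alpha>)) ^ n)"
      using le ml_coeff_pos[of n] by (simp add: abs_mult power_abs S_def[symmetric] S0 mult_ac)
  qed
qed

lemma ml_profile_0 [simp]: "ml_profile \<alpha> c 0 = 1"
  unfolding ml_profile_def mittag_leffler3_def
  using powser_zero[of "\<lambda>n. ml_coeff \<alpha> n"] \<alpha> by (simp add: ml_coeff_def)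

text \<open>At \<open>x = 0\<close> the series would lose its constant term 1, because
  \<open>0 powr 0 = 0\<close>.\<close>

lemma ml_profile_series:
  assumes "x > 0"
  shows "ml_profile \<alpha> c x = (\<Sum>n. ml_coeff \<alpha> n * (- c) ^ n * x powr ((1 + \<alpha>) * n))"
proof -
  have "(- (c * x powr (1 + \<alpha>))) ^ n = (- c) ^ n * x powr ((1 + \<alpha>) * n)" for n
    using power_mult_distrib[of "- c" "x powr (1 + \<alpha>)" n] assms
    by (simp add: power_eq_powr_mult)
  then show ?thesis unfolding ml_profile_def mittag_leffler3_def by (simp add: mult.assoc)
qed

lemma DERIV_mittag_leffler3:
  "((mittag_leffler3 \<alpha> :: real \<Rightarrow> real) has_real_derivative (\<Sum>n. diffs (ml_coeff \<alpha>) n * z ^ n)) (at z)"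
  using termdiffs_strong_converges_everywhere[of "ml_coeff \<alpha>" z, OF summable_ml_coeff]
  by (simp add: mittag_leffler3_def[abs_def])

lemma DERIV_ml_profile:
  assumes x: "x > 0"
  shows "(ml_profile \<alpha> c has_real_derivative ml_profile_deriv \<alpha> c x) (at x)"
proof -
  define z where "z = - (c * x powr (1 + \<alpha>))"
  have "((\<lambda>x. - (c * x powr (1 + \<alpha>))) has_real_derivative - (c * ((1 + \<alpha>) * x powr \<alpha>))) (at x)"
    using x by (auto intro!: derivative_eq_intros)
  from DERIV_chain2[OF DERIV_mittag_leffler3 this]
  have "(ml_profile \<alpha> c has_real_derivative
      (\<Sum>n. diffs (ml_coeff \<alpha>) n * z ^ n) * - (c * ((1 + \<alpha>) * x powr \<alpha>))) (at x)"
    by (simp add: ml_profile_def[abs_def] z_def)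
  also have "(\<Sum>n. diffs (ml_coeff \<alpha>) n * z ^ n) * - (c * ((1 + \<alpha>) * x powr \<alpha>)) =
      (\<Sum>n. diffs (ml_coeff \<alpha>) n * z ^ n * - (c * ((1 + \<alpha>) * x powr \<alpha>)))"
    by (intro suminf_mult2 termdiff_converges_all summable_ml_coeff)
  also have "\<dots> = ml_profile_deriv \<alpha> c x" unfolding ml_profile_deriv_def
  proof (rule suminf_cong)
    fix n
    have z: "z ^ n = (- c) ^ n * x powr ((1 + \<alpha>) * n)"
      using power_mult_distrib[of "- c" "x powr (1 + \<alpha>)" n] x
      by (simp add: power_eq_powr_mult z_def)
    have "(1 + \<alpha>) * Suc n - 1 = (1 + \<alpha>) * n + \<alpha>" by (simp add: algebra_simps)
    then have p: "x powr ((1 + \<alpha>) * Suc n - 1) = x powr ((1 + \<alpha>) * n) * x powr \<alpha>"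
      by (simp only: powr_add)
    show "diffs (ml_coeff \<alpha>) n * z ^ n * - (c * ((1 + \<alpha>) * x powr \<alpha>)) =
      ml_coeff \<alpha> (Suc n) * (- c) ^ Suc n * ((1 + \<alpha>) * Suc n) * x powr ((1 + \<alpha>) * Suc n - 1)"
      unfolding z p diffs_def by simp
  qed
  finally show ?thesis .
qed

lemma continuous_on_ml_profile: "continuous_on {0..} (ml_profile \<alpha> c)"
proof -
  have "continuous_on UNIV (mittag_leffler3 \<alpha> :: real \<Rightarrow> real)"
    by (intro continuous_at_imp_continuous_on ballI DERIV_isCont[OF DERIV_mittag_leffler3])
  moreover have "continuous_on {0..} (\<lambda>x. - (c * x powr (1 + \<alpha>)))"
    using \<alpha> by (intro continuous_on_minus continuous_on_mult continuous_on_const continuous_on_powr'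
      continuous_on_id) auto
  ultimately show ?thesis unfolding ml_profile_def[abs_def]
    by (rule continuous_on_compose2) auto
qed

section \<open>Fractional equations for the profile\<close>

lemma Gamma_pos:
  "Gamma ((1 + \<alpha>) * real n + 2) > 0" "Gamma ((1 + \<alpha>) * real n + 2 + \<alpha>) > 0"
  using \<alpha> by (intro Gamma_real_pos add_nonneg_pos; simp)+

text \<open>The recurrence cleared of denominators. In the equations below it absorbs the Gamma
  quotients left by the Beta integrals and shifts the index by one.\<close>

lemma ml_coeff_Suc_Gamma:
  "ml_coeff \<alpha> (Suc n) * Gamma ((1 + \<alpha>) * n + 2 + \<alpha>) = ml_coeff \<alpha> n * Gamma ((1 + \<alpha>) * n + 2)"
  using Gamma_pos(2)[of n] by (simp add: ml_coeff_Suc)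

text \<open>The Caputo equation, with the normalising factor \<open>1 / Gamma (1 - \<alpha>)\<close>
  moved to the right-hand side. The fractional integral takes the derivative of the term of index
  \<open>n + 1\<close> to a multiple of \<open>x\<close> times the term of index
  \<open>n\<close>.\<close>

lemma ml_profile_deriv_caputo:
  assumes x: "x > 0"
  shows "((\<lambda>s. ml_profile_deriv \<alpha> c s * (x - s) powr (- \<alpha>)) has_integral
    (- c * Gamma (1 - \<alpha>) * x * ml_profile \<alpha> c x)) {0..x}"
proof -
  define a where "a n = ml_coeff \<alpha> (Suc n) * (- c) ^ Suc n * ((1 + \<alpha>) * Suc n)" for n
  define p where "p n = (1 + \<alpha>) * Suc n" for n
  have summ: "summable (\<lambda>n. \<bar>a n\<bar> * s powr (p n - 1))" if "s > 0" for s
  proof -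
    from summable_ml_profile_linear[OF that, of c "1 + \<alpha>" 0 "-1"] show ?thesis
      by (subst (asm) summable_Suc_iff[symmetric]) (simp add: a_def p_def)
  qed
  have "((\<lambda>s. (\<Sum>n. a n * s powr (p n - 1)) * (x - s) powr ((1 - \<alpha>) - 1)) has_integral
      (\<Sum>n. a n * Beta (p n) (1 - \<alpha>) * x powr (p n + (1 - \<alpha>) - 1))) {0..x}"
    using \<alpha> x summ by (intro fractional_integral_series[of "1 - \<alpha>" "1 + \<alpha>"])
       (auto simp: p_def algebra_simps)
  also have "(\<lambda>n. a n * Beta (p n) (1 - \<alpha>) * x powr (p n + (1 - \<alpha>) - 1)) =
      (\<lambda>n. (- c * Gamma (1 - \<alpha>) * x) * (ml_coeff \<alpha> n * (- c) ^ n * x powr ((1 + \<alpha>) * n)))"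
  proof
    fix n
    have pn: "p n > 0" using \<alpha> by (simp add: p_def)
    have "p n + 1 = (1 + \<alpha>) * n + 2 + \<alpha>" by (simp add: p_def algebra_simps)
    \<comment> \<open>The factor \<open>p n\<close> left by differentiation raises
      \<open>Gamma (p n)\<close> to the Gamma value that occurs in the recurrence.\<close>
    moreover have "Gamma (p n + 1) = p n * Gamma (p n)"
      using pn by (intro Gamma_plus1) (auto elim!: nonpos_Ints_cases)
    moreover have e: "p n + (1 - \<alpha>) = (1 + \<alpha>) * n + 2" by (simp add: p_def algebra_simps)
    ultimately have "a n * Beta (p n) (1 - \<alpha>) =
        (- c) ^ Suc n * Gamma (1 - \<alpha>) *
        (ml_coeff \<alpha> (Suc n) * Gamma ((1 + \<alpha>) * n + 2 + \<alpha>)) / Gamma ((1 + \<alpha>) * n + 2)"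
      unfolding a_def p_def[symmetric] Beta_def by (simp only:) simp
    also have "\<dots> = (- c) ^ Suc n * Gamma (1 - \<alpha>) * ml_coeff \<alpha> n"
      unfolding ml_coeff_Suc_Gamma
      using Gamma_pos(1)[of n] by simp
    finally have "a n * Beta (p n) (1 - \<alpha>) = (- c) ^ Suc n * Gamma (1 - \<alpha>) * ml_coeff \<alpha> n" .
    moreover have "x powr (p n + (1 - \<alpha>) - 1) = x * x powr ((1 + \<alpha>) * n)"
      unfolding e using x by (simp add: powr_add)
    ultimately show "a n * Beta (p n) (1 - \<alpha>) * x powr (p n + (1 - \<alpha>) - 1) =
      (- c * Gamma (1 - \<alpha>) * x) * (ml_coeff \<alpha> n * (- c) ^ n * x powr ((1 + \<alpha>) * n))" by simp
  qed
  also have "(\<Sum>n. (- c * Gamma (1 - \<alpha>) * x) * (ml_coeff \<alpha> n * (- c) ^ n * x powr ((1 + \<alpha>) * n))) =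
      - c * Gamma (1 - \<alpha>) * x * ml_profile \<alpha> c x"
    unfolding ml_profile_series[OF x]
    using summable_ml_profile_linear[OF x, of c 0 1 0]
    by (intro suminf_mult summable_norm_cancel[of "\<lambda>n. ml_coeff \<alpha> n * (- c) ^ n * x powr ((1 + \<alpha>) * n)"])
      (simp add: abs_mult)
  finally show ?thesis
    by (simp add: ml_profile_deriv_def a_def p_def)
qed

text \<open>The Caputo equation in integrated form, with initial value 1. Each Beta integral
  produces the next term of the profile up to a constant factor, so that the resulting sum lacks
  exactly the head term 1.\<close>

lemma ml_profile_volterra:
  assumes x: "x > 0" and c: "c \<noteq> 0"
  shows "((\<lambda>s. s * ml_profile \<alpha> c s * (x - s) powr (\<alpha> - 1)) has_integral
    (Gamma \<alpha> / c * (1 - ml_profile \<alpha> c x))) {0..x}"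
proof -
  define a where "a n = ml_coeff \<alpha> n * (- c) ^ n" for n
  define p where "p n = (1 + \<alpha>) * real n + 2" for n
  have summ: "summable (\<lambda>n. \<bar>a n\<bar> * s powr (p n - 1))" if "s > 0" for s
    using summable_ml_profile_linear[OF that, of c 0 1 1] by (simp add: a_def p_def add.commute)
  have "((\<lambda>s. (\<Sum>n. a n * s powr (p n - 1)) * (x - s) powr (\<alpha> - 1)) has_integral
      (\<Sum>n. a n * Beta (p n) \<alpha> * x powr (p n + \<alpha> - 1))) {0..x}"
    using \<alpha> x summ by (intro fractional_integral_series[of \<alpha> 2]) (auto simp: p_def)
  also have "(\<lambda>n. a n * Beta (p n) \<alpha> * x powr (p n + \<alpha> - 1)) =
      (\<lambda>n. (- Gamma \<alpha> / c) * (ml_coeff \<alpha> (Suc n) * (- c) ^ Suc n * x powr ((1 + \<alpha>) * Suc n)))"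
  proof
    fix n
    have "a n * Beta (p n) \<alpha> =
        (- c) ^ n * Gamma \<alpha> * (ml_coeff \<alpha> n * Gamma ((1 + \<alpha>) * n + 2)) / Gamma ((1 + \<alpha>) * n + 2 + \<alpha>)"
      unfolding a_def p_def Beta_def by simp
    also have "\<dots> = (- c) ^ n * Gamma \<alpha> * ml_coeff \<alpha> (Suc n)"
      unfolding ml_coeff_Suc_Gamma[symmetric]
      using Gamma_pos(2)[of n] by simp
    finally have "a n * Beta (p n) \<alpha> = (- c) ^ n * Gamma \<alpha> * ml_coeff \<alpha> (Suc n)" .
    moreover have "p n + \<alpha> - 1 = (1 + \<alpha>) * Suc n" by (simp add: p_def algebra_simps)
    ultimately show "a n * Beta (p n) \<alpha> * x powr (p n + \<alpha> - 1) =
      (- Gamma \<alpha> / c) * (ml_coeff \<alpha> (Suc n) * (- c) ^ Suc n * x powr ((1 + \<alpha>) * Suc n))"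
      using c by simp
  qed
  also have "(\<Sum>n. (- Gamma \<alpha> / c) * (ml_coeff \<alpha> (Suc n) * (- c) ^ Suc n * x powr ((1 + \<alpha>) * Suc n))) =
      Gamma \<alpha> / c * (1 - ml_profile \<alpha> c x)"
  proof -
    have s: "summable (\<lambda>n. ml_coeff \<alpha> n * (- c) ^ n * x powr ((1 + \<alpha>) * n))"
      using summable_ml_profile_linear[OF x, of c 0 1 0]
      by (intro summable_norm_cancel[of "\<lambda>n. ml_coeff \<alpha> n * (- c) ^ n * x powr ((1 + \<alpha>) * n)"])
        (simp add: abs_mult)
    then have s': "summable (\<lambda>n. ml_coeff \<alpha> (Suc n) * (- c) ^ Suc n * x powr ((1 + \<alpha>) * Suc n))"
      by (subst summable_Suc_iff)
    have "(\<Sum>n. ml_coeff \<alpha> (Suc n) * (- c) ^ Suc n * x powr ((1 + \<alpha>) * Suc n)) = ml_profile \<alpha> c x - 1"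
      using suminf_split_head[OF s] x by (simp add: ml_profile_series ml_coeff_def)
    with suminf_mult[OF s', of "- Gamma \<alpha> / c"] show ?thesis
      by (simp only:) (simp add: algebra_simps diff_divide_distrib)
  qed
  finally show ?thesis
  proof (rule has_integral_eq[rotated])
    fix s assume s: "s \<in> {0..x}"
    show "(\<Sum>n. a n * s powr (p n - 1)) * (x - s) powr (\<alpha> - 1) =
       s * ml_profile \<alpha> c s * (x - s) powr (\<alpha> - 1)"
    proof (cases "s = 0")
      case False
      then have s0: "s > 0" using s by simp
      have "s powr (p n - 1) = s * s powr ((1 + \<alpha>) * n)" for n
        using s0 by (simp add: p_def powr_add)
      then have "(\<Sum>n. a n * s powr (p n - 1)) = (\<Sum>n. s * (a n * s powr ((1 + \<alpha>) * n)))"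
        by (simp add: mult_ac)
      also have "\<dots> = s * (\<Sum>n. a n * s powr ((1 + \<alpha>) * n))"
        using summable_ml_profile_linear[OF s0, of c 0 1 0]
        by (intro suminf_mult summable_norm_cancel[of "\<lambda>n. a n * s powr ((1 + \<alpha>) * n)"])
          (simp add: abs_mult a_def)
      finally show ?thesis using s0 by (simp add: ml_profile_series a_def)
    qed simp
  qed
qed

text \<open>Formally this is \<open>ml_profile_volterra\<close> differentiated in \<open>x\<close>,
  where the derivative passes to \<open>s * ml_profile \<alpha> c s\<close> since that product
  vanishes at 0. Working termwise avoids differentiation under the singular kernel.\<close>

lemma ml_profile_deriv_volterra:
  assumes x: "x > 0" and c: "c \<noteq> 0"
  shows "((\<lambda>s. (ml_profile \<alpha> c s + s * ml_profile_deriv \<alpha> c s) * (x - s) powr (\<alpha> - 1)) has_integral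
    (- Gamma \<alpha> / c * ml_profile_deriv \<alpha> c x)) {0..x}"
proof -
  define a where "a n = ml_coeff \<alpha> n * (- c) ^ n * ((1 + \<alpha>) * real n + 1)" for n
  define p where "p n = (1 + \<alpha>) * real n + 1" for n
  have summ: "summable (\<lambda>n. \<bar>a n\<bar> * s powr (p n - 1))" if "s > 0" for s
    using summable_ml_profile_linear[OF that, of c "1 + \<alpha>" 1 0] by (simp add: a_def p_def)
  have "((\<lambda>s. (\<Sum>n. a n * s powr (p n - 1)) * (x - s) powr (\<alpha> - 1)) has_integral
      (\<Sum>n. a n * Beta (p n) \<alpha> * x powr (p n + \<alpha> - 1))) {0..x}"
    using \<alpha> x summ by (intro fractional_integral_series[of \<alpha> 1]) (auto simp: p_def)
  also have "(\<lambda>n. a n * Beta (p n) \<alpha> * x powr (p n + \<alpha> - 1)) =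
      (\<lambda>n. (- Gamma \<alpha> / c) * (ml_coeff \<alpha> (Suc n) * (- c) ^ Suc n * ((1 + \<alpha>) * Suc n) *
        x powr ((1 + \<alpha>) * Suc n - 1)))"
  proof
    fix n
    have pn: "p n > 0" using \<alpha> by (auto simp: p_def intro!: add_nonneg_pos)
    have e: "p n + \<alpha> = (1 + \<alpha>) * Suc n" by (simp add: p_def algebra_simps)
    have "Gamma (p n + 1) = p n * Gamma (p n)"
      using pn by (intro Gamma_plus1) (auto elim!: nonpos_Ints_cases)
    moreover have "p n + 1 = (1 + \<alpha>) * n + 2" by (simp add: p_def)
    ultimately have "a n * Beta (p n) \<alpha> =
        (- c) ^ n * Gamma \<alpha> * (ml_coeff \<alpha> n * Gamma ((1 + \<alpha>) * n + 2)) / Gamma (p n + \<alpha>)"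
      unfolding a_def p_def[symmetric] Beta_def by (simp only:) simp
    also have "\<dots> = (- c) ^ n * Gamma \<alpha> * (ml_coeff \<alpha> (Suc n) * Gamma ((1 + \<alpha>) * n + 2 + \<alpha>)) / Gamma (p n + \<alpha>)"
      unfolding ml_coeff_Suc_Gamma ..
    also have "(1 + \<alpha>) * n + 2 + \<alpha> = (p n + \<alpha>) + 1" by (simp add: p_def)
    also have "Gamma ((p n + \<alpha>) + 1) = (p n + \<alpha>) * Gamma (p n + \<alpha>)"
      using pn \<alpha> by (intro Gamma_plus1) (auto elim!: nonpos_Ints_cases)
    also have "(- c) ^ n * Gamma \<alpha> * (ml_coeff \<alpha> (Suc n) * ((p n + \<alpha>) * Gamma (p n + \<alpha>))) / Gamma (p n + \<alpha>)
        = (- c) ^ n * Gamma \<alpha> * ml_coeff \<alpha> (Suc n) * (p n + \<alpha>)"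
    proof -
      have "Gamma (p n + \<alpha>) > 0" using pn \<alpha> by (intro Gamma_real_pos) simp
      then show ?thesis by simp
    qed
    finally show "a n * Beta (p n) \<alpha> * x powr (p n + \<alpha> - 1) =
      (- Gamma \<alpha> / c) * (ml_coeff \<alpha> (Suc n) * (- c) ^ Suc n * ((1 + \<alpha>) * Suc n) *
        x powr ((1 + \<alpha>) * Suc n - 1))"
      unfolding e using c by simp
  qed
  also have "(\<Sum>n. (- Gamma \<alpha> / c) * (ml_coeff \<alpha> (Suc n) * (- c) ^ Suc n * ((1 + \<alpha>) * Suc n) *
        x powr ((1 + \<alpha>) * Suc n - 1))) = - Gamma \<alpha> / c * ml_profile_deriv \<alpha> c x"
    unfolding ml_profile_deriv_def
  proof (rule suminf_mult)
    have "summable (\<lambda>n. \<bar>ml_coeff \<alpha> n * (- c) ^ n * ((1 + \<alpha>) * real n + 0)\<bar> * x powr ((1 + \<alpha>) * n + (-1)))"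
      by (rule summable_ml_profile_linear[OF x])
    then have "summable (\<lambda>n. \<bar>ml_coeff \<alpha> (Suc n) * (- c) ^ Suc n * ((1 + \<alpha>) * Suc n + 0)\<bar> * x powr ((1 + \<alpha>) * Suc n + (-1)))"
      by (subst summable_Suc_iff)
    then show "summable (\<lambda>n. ml_coeff \<alpha> (Suc n) * (- c) ^ Suc n * ((1 + \<alpha>) * Suc n) * x powr ((1 + \<alpha>) * Suc n - 1))"
      by (intro summable_norm_cancel[where f = "\<lambda>n. ml_coeff \<alpha> (Suc n) * (- c) ^ Suc n * ((1 + \<alpha>) * Suc n) * x powr ((1 + \<alpha>) * Suc n - 1)"])
        (simp add: abs_mult)
  qed
  finally show ?thesis
  \<comment> \<open>The point 0 is exceptional: the series is 0 there, again by
    \<open>0 powr 0 = 0\<close>, whereas \<open>ml_profile \<alpha> c 0 = 1\<close>.\<close>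
  proof (rule has_integral_spike_finite[where S = "{0}", rotated 2])
    fix s assume s: "s \<in> {0..x} - {0}"
    then have s0: "s > 0" by simp
    have "(\<lambda>n. ml_coeff \<alpha> n * (- c) ^ n * s powr ((1 + \<alpha>) * n)) sums ml_profile \<alpha> c s"
      unfolding ml_profile_series[OF s0] using summable_ml_profile_linear[OF s0, of c 0 1 0]
      by (intro summable_sums summable_norm_cancel[where f = "\<lambda>n. ml_coeff \<alpha> n * (- c) ^ n * s powr ((1 + \<alpha>) * n)"])
        (simp add: abs_mult)
    moreover have "(\<lambda>n. s * (ml_coeff \<alpha> n * (- c) ^ n * ((1 + \<alpha>) * n) * s powr ((1 + \<alpha>) * n - 1)))
       sums (s * ml_profile_deriv \<alpha> c s)"
    proof (rule sums_mult)
      \<comment> \<open>The term of index 0 carries the factor \<open>n = 0\<close>, so this series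
        has the same sum as the shifted one in \<open>ml_profile_deriv\<close>.\<close>
      let ?d = "\<lambda>n. ml_coeff \<alpha> n * (- c) ^ n * ((1 + \<alpha>) * n) * s powr ((1 + \<alpha>) * n - 1)"
      have "summable ?d"
        using summable_ml_profile_linear[OF s0, of c "1 + \<alpha>" 0 "-1"]
        by (intro summable_norm_cancel[of ?d]) (simp add: abs_mult)
      then have "?d sums suminf ?d" and "(\<Sum>n. ?d (Suc n)) = suminf ?d - ?d 0"
        by (rule summable_sums, rule suminf_split_head)
      moreover have "?d 0 = 0" by simp
      ultimately show "?d sums ml_profile_deriv \<alpha> c s" unfolding ml_profile_deriv_def by (simp only: diff_0_right)
    qed
    ultimately have "(\<lambda>n. ml_coeff \<alpha> n * (- c) ^ n * s powr ((1 + \<alpha>) * n) +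
       s * (ml_coeff \<alpha> n * (- c) ^ n * ((1 + \<alpha>) * n) * s powr ((1 + \<alpha>) * n - 1))) sums
       (ml_profile \<alpha> c s + s * ml_profile_deriv \<alpha> c s)" by (rule sums_add)
    also have "(\<lambda>n. ml_coeff \<alpha> n * (- c) ^ n * s powr ((1 + \<alpha>) * n) +
       s * (ml_coeff \<alpha> n * (- c) ^ n * ((1 + \<alpha>) * n) * s powr ((1 + \<alpha>) * n - 1))) =
       (\<lambda>n. a n * s powr (p n - 1))"
    proof
      fix n :: nat
      define S P where "S = s powr ((1 + \<alpha>) * n)" and "P = s powr ((1 + \<alpha>) * n - 1)"
      have "S = s * P" using s0 by (simp add: S_def P_def powr_diff)
      moreover have "s powr (p n - 1) = S" by (simp add: p_def S_def)
      ultimately show "ml_coeff \<alpha> n * (- c) ^ n * s powr ((1 + \<alpha>) * n) +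
          s * (ml_coeff \<alpha> n * (- c) ^ n * ((1 + \<alpha>) * n) * s powr ((1 + \<alpha>) * n - 1)) =
          a n * s powr (p n - 1)"
        unfolding S_def[symmetric] P_def[symmetric] by (simp add: a_def algebra_simps)
    qed
    finally have "(\<Sum>n. a n * s powr (p n - 1)) = ml_profile \<alpha> c s + s * ml_profile_deriv \<alpha> c s"
      by (rule sums_unique[symmetric])
    then show "(ml_profile \<alpha> c s + s * ml_profile_deriv \<alpha> c s) * (x - s) powr (\<alpha> - 1) =
       (\<Sum>n. a n * s powr (p n - 1)) * (x - s) powr (\<alpha> - 1)" by simp
  qed simp
qed

section \<open>Sign and monotonicity of the profile\<close>

text \<open>Where the profile is negative, the right-hand side of its Caputo equation is
  nonnegative; this is the situation excluded by \<open>caputo_comparison\<close>.\<close>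

lemma ml_profile_nonneg:
  assumes "c > 0" "x \<ge> 0"
  shows "ml_profile \<alpha> c x \<ge> 0"
proof (rule caputo_comparison[OF \<alpha> continuous_on_ml_profile DERIV_ml_profile])
  fix x :: real assume x: "0 < x" and neg: "ml_profile \<alpha> c x < 0"
  have "- c * Gamma (1 - \<alpha>) * x * ml_profile \<alpha> c x \<ge> 0"
    using x neg assms(1) \<alpha> by (intro mult_nonpos_nonpos) (auto intro!: mult_nonneg_nonneg)
  with ml_profile_deriv_caputo[OF x]
  show "\<exists>I\<ge>0. ((\<lambda>s. ml_profile_deriv \<alpha> c s * (x - s) powr - \<alpha>) has_integral I) {0..x}" by blast
qed (use assms in auto)

text \<open>Comparison applied to the difference of the two profiles. Where it is negative, the
  larger parameter \<open>d\<close> meets the larger of two nonnegative values, so \<open>c *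
  ml_profile \<alpha> c x \<le> d * ml_profile \<alpha> d x\<close> and the Caputo integral of the
  difference is nonnegative.\<close>

lemma ml_profile_mono_param:
  assumes "0 < c" "c \<le> d" "x \<ge> 0"
  shows "ml_profile \<alpha> d x \<le> ml_profile \<alpha> c x"
proof -
  have "0 \<le> ml_profile \<alpha> c x - ml_profile \<alpha> d x"
  proof (rule caputo_comparison[OF \<alpha>, where W = "\<lambda>x. ml_profile \<alpha> c x - ml_profile \<alpha> d x"])
    show "continuous_on {0..} (\<lambda>x. ml_profile \<alpha> c x - ml_profile \<alpha> d x)"
      by (intro continuous_intros continuous_on_ml_profile)
    show "((\<lambda>x. ml_profile \<alpha> c x - ml_profile \<alpha> d x) has_real_derivative
      ml_profile_deriv \<alpha> c x - ml_profile_deriv \<alpha> d x) (at x)" if "x > 0" for x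
      using that by (intro DERIV_diff DERIV_ml_profile)
    fix x :: real assume x: "0 < x" and neg: "ml_profile \<alpha> c x - ml_profile \<alpha> d x < 0"
    let ?I = "- c * Gamma (1 - \<alpha>) * x * ml_profile \<alpha> c x - (- d * Gamma (1 - \<alpha>) * x * ml_profile \<alpha> d x)"
    have "c * ml_profile \<alpha> c x \<le> d * ml_profile \<alpha> d x"
      using neg x assms ml_profile_nonneg[of c x] by (intro mult_mono) auto
    then have "0 \<le> (d * ml_profile \<alpha> d x - c * ml_profile \<alpha> c x) * (Gamma (1 - \<alpha>) * x)"
      using x \<alpha> by (intro mult_nonneg_nonneg) auto
    then have "0 \<le> ?I" by (simp add: algebra_simps)
    moreover have "((\<lambda>s. (ml_profile_deriv \<alpha> c s - ml_profile_deriv \<alpha> d s) * (x - s) powr - \<alpha>) has_integral ?I) {0..x}"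
      using has_integral_diff[OF ml_profile_deriv_caputo[OF x] ml_profile_deriv_caputo[OF x]]
      by (simp add: left_diff_distrib)
    ultimately show "\<exists>I\<ge>0. ((\<lambda>s. (ml_profile_deriv \<alpha> c s - ml_profile_deriv \<alpha> d s) * (x - s) powr - \<alpha>) has_integral I) {0..x}"
      by blast
  qed (use assms in auto)
  then show ?thesis by simp
qed

text \<open>For \<open>x > 0\<close>, passing from \<open>x\<close> to \<open>y\<close> is a
  dilation, that is, an increase of the parameter at the fixed point \<open>x\<close>. No dilation
  moves \<open>x = 0\<close>; there the Volterra equation with its nonnegative integrand gives the
  upper bound 1.\<close>

lemma ml_profile_antimono:
  assumes "c > 0" "0 \<le> x" "x \<le> y"
  shows "ml_profile \<alpha> c y \<le> ml_profile \<alpha> c x"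
proof (cases "x = 0")
  case False
  then have x: "x > 0" using assms by simp
  have "ml_profile \<alpha> c y = ml_profile \<alpha> (c * (y / x) powr (1 + \<alpha>)) x"
    unfolding ml_profile_def using assms x by (simp add: powr_divide)
  also have "\<dots> \<le> ml_profile \<alpha> c x"
    using assms x \<alpha> by (intro ml_profile_mono_param) (auto intro!: ge_one_powr_ge_zero)
  finally show ?thesis .
next
  case True
  show ?thesis
  proof (cases "y = 0")
    case False
    with True assms have y: "y > 0" by simp
    have "0 \<le> Gamma \<alpha> / c * (1 - ml_profile \<alpha> c y)"
    proof (rule has_integral_nonneg[OF ml_profile_volterra[OF y]])
      fix s assume "s \<in> {0..y}"
      then show "0 \<le> s * ml_profile \<alpha> c s * (y - s) powr (\<alpha> - 1)"
        using ml_profile_nonneg[of c s] assms by simp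
    qed (use assms in simp)
    moreover have "Gamma \<alpha> / c > 0" using assms \<alpha> by simp
    ultimately have "0 \<le> 1 - ml_profile \<alpha> c y" by (metis zero_le_mult_iff not_le)
    then show ?thesis using True by simp
  qed (use True in simp)
qed

lemma ml_profile_le_1: "c > 0 \<Longrightarrow> x \<ge> 0 \<Longrightarrow> ml_profile \<alpha> c x \<le> 1"
  using ml_profile_antimono[of c 0 x] by simp

lemma ml_profile_deriv_nonpos:
  assumes "c > 0" "x > 0"
  shows "ml_profile_deriv \<alpha> c x \<le> 0"
proof (rule ccontr)
  assume "\<not> ?thesis"
  with DERIV_pos_inc_right[OF DERIV_ml_profile[OF assms(2)], of c]
  obtain d where "d > 0" "\<And>h. 0 < h \<Longrightarrow> h < d \<Longrightarrow> ml_profile \<alpha> c x < ml_profile \<alpha> c (x + h)" by auto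
  then have "ml_profile \<alpha> c x < ml_profile \<alpha> c (x + d / 2)" by simp
  moreover have "ml_profile \<alpha> c (x + d / 2) \<le> ml_profile \<alpha> c x"
    using assms \<open>d > 0\<close> by (intro ml_profile_antimono) auto
  ultimately show False by simp
qed

section \<open>Derivative bound and Lipschitz continuity\<close>

text \<open>Supplies the correction near the origin in \<open>ml_profile_deriv_bound\<close>. For
  \<open>m = x\<close> the kernel is singular at the right endpoint, but its primitive stays
  continuous there.\<close>

lemma has_integral_initial_kernel:
  assumes x: "0 < x" "m \<le> x" "0 \<le> m"
  shows "((\<lambda>s. indicat_real {..m} s * (x - s) powr (\<alpha> - 1)) has_integral
    ((x powr \<alpha> - (x - m) powr \<alpha>) / \<alpha>)) {0..x}"
proof -
  have "((\<lambda>s. (x - s) powr (\<alpha> - 1)) has_integral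
      (- ((x - m) powr \<alpha>) / \<alpha> - (- ((x - 0) powr \<alpha>) / \<alpha>))) {0..m}"
  proof (rule fundamental_theorem_of_calculus_interior)
    show "continuous_on {0..m} (\<lambda>s. - ((x - s) powr \<alpha>) / \<alpha>)"
      using \<alpha> x by (intro continuous_on_powr' continuous_intros) auto
    fix s assume s: "s \<in> {0<..<m}"
    have "((\<lambda>s. - ((x - s) powr \<alpha>) / \<alpha>) has_real_derivative (x - s) powr (\<alpha> - 1)) (at s)"
      using s x \<alpha> by (auto intro!: derivative_eq_intros)
    then show "((\<lambda>s. - ((x - s) powr \<alpha>) / \<alpha>) has_vector_derivative (x - s) powr (\<alpha> - 1)) (at s)"
      by (simp add: has_real_derivative_iff_has_vector_derivative)
  qed (use x in simp)
  then have "((\<lambda>s. if s \<in> {0..m} then (x - s) powr (\<alpha> - 1) else 0) has_integral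
      ((x powr \<alpha> - (x - m) powr \<alpha>) / \<alpha>)) {0..x}"
    using x by (subst has_integral_restrict) (auto simp: diff_divide_distrib)
  then show ?thesis
    by (rule has_integral_eq[rotated]) (auto simp: indicator_def)
qed

text \<open>The bound arises as 1 + 1. After division by \<open>Gamma \<alpha> / c\<close>, the
  Volterra integral contributes \<open>1 - ml_profile \<alpha> c x \<le> 1\<close>, and the
  correction for \<open>s \<le> 1\<close> contributes at most \<open>c / (\<alpha> * Gamma \<alpha>)
  = 1 / Gamma (\<alpha> + 2) \<le> 1\<close>.\<close>

lemma ml_profile_deriv_bound:
  assumes "x > 0"
  shows "- 2 \<le> ml_profile_deriv \<alpha> (1 / (1 + \<alpha>)) x"
proof -
  define c where "c = 1 / (1 + \<alpha>)"
  define m where "m = min x 1"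
  have c: "c > 0" using \<alpha> by (simp add: c_def)
  have "- Gamma \<alpha> / c * ml_profile_deriv \<alpha> c x \<le>
      Gamma \<alpha> / c * (1 - ml_profile \<alpha> c x) + (x powr \<alpha> - (x - m) powr \<alpha>) / \<alpha>"
  proof (rule has_integral_le)
    show "((\<lambda>s. (ml_profile \<alpha> c s + s * ml_profile_deriv \<alpha> c s) * (x - s) powr (\<alpha> - 1)) has_integral
      (- Gamma \<alpha> / c * ml_profile_deriv \<alpha> c x)) {0..x}"
      using ml_profile_deriv_volterra assms c by simp
    show "((\<lambda>s. s * ml_profile \<alpha> c s * (x - s) powr (\<alpha> - 1) + indicat_real {..m} s * (x - s) powr (\<alpha> - 1)) has_integral
      (Gamma \<alpha> / c * (1 - ml_profile \<alpha> c x) + (x powr \<alpha> - (x - m) powr \<alpha>) / \<alpha>)) {0..x}"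
      using assms c by (intro has_integral_add ml_profile_volterra has_integral_initial_kernel) (auto simp: m_def)
    fix s assume s: "s \<in> {0..x}"
    have "s * ml_profile_deriv \<alpha> c s \<le> 0"
      using s c ml_profile_deriv_nonpos[of c s] by (cases "s = 0") (auto simp: mult_nonneg_nonpos)
    moreover have "ml_profile \<alpha> c s \<le> s * ml_profile \<alpha> c s + indicat_real {..m} s"
    proof (cases "s \<le> m")
      case True
      then show ?thesis using s c ml_profile_le_1[of c s] ml_profile_nonneg[of c s]
        by (simp add: add_increasing)
    next
      case False
      \<comment> \<open>From \<open>m < s \<le> x\<close> it follows that \<open>m\<close> is 1 and
        not \<open>x\<close>.\<close>
      then have "1 \<le> s" using s by (auto simp: m_def)
      then show ?thesis using s c ml_profile_nonneg[of c s] False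
        by (simp add: mult_left_le_one_le mult_le_cancel_right1)
    qed
    ultimately have "ml_profile \<alpha> c s + s * ml_profile_deriv \<alpha> c s \<le> s * ml_profile \<alpha> c s + indicat_real {..m} s"
      by simp
    from mult_right_mono[OF this, of "(x - s) powr (\<alpha> - 1)"]
    show "(ml_profile \<alpha> c s + s * ml_profile_deriv \<alpha> c s) * (x - s) powr (\<alpha> - 1) \<le>
      s * ml_profile \<alpha> c s * (x - s) powr (\<alpha> - 1) + indicat_real {..m} s * (x - s) powr (\<alpha> - 1)"
      by (simp add: distrib_right)
  qed
  also have "\<dots> \<le> Gamma \<alpha> / c + 1 / \<alpha>"
  proof (intro add_mono divide_right_mono)
    show "Gamma \<alpha> / c * (1 - ml_profile \<alpha> c x) \<le> Gamma \<alpha> / c"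
      using ml_profile_nonneg[of c x] c \<alpha> assms by (intro mult_right_le_one_le) (auto intro: ml_profile_le_1)
    show "x powr \<alpha> - (x - m) powr \<alpha> \<le> 1"
    proof (cases "x \<le> 1")
      case True
      then show ?thesis using assms \<alpha> by (simp add: m_def powr_le1)
    next
      case False
      \<comment> \<open>Split \<open>x powr \<alpha>\<close> as
        \<open>(x - 1) * x powr (\<alpha> - 1) + x powr (\<alpha> - 1)\<close>: the first summand is
        at most \<open>(x - 1) powr \<alpha>\<close>, the second at most 1.\<close>
      have "x powr \<alpha> = x * x powr (\<alpha> - 1)" using assms by (simp add: powr_diff)
      moreover have "(x - 1) powr \<alpha> = (x - 1) * (x - 1) powr (\<alpha> - 1)" using False by (simp add: powr_diff)
      moreover have "(x - 1) * x powr (\<alpha> - 1) \<le> (x - 1) * (x - 1) powr (\<alpha> - 1)"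
        using False \<alpha> by (intro mult_left_mono powr_mono2') auto
      moreover have "x powr (\<alpha> - 1) \<le> 1"
        using powr_mono[of "\<alpha> - 1" 0 x] False \<alpha> by simp
      ultimately show ?thesis using False by (simp add: m_def algebra_simps)
    qed
  qed (use \<alpha> in simp)
  also have "1 / \<alpha> \<le> Gamma \<alpha> / c"
  proof -
    have "Gamma (\<alpha> + 1) = \<alpha> * Gamma \<alpha>"
      using \<alpha> by (intro Gamma_plus1) (auto elim!: nonpos_Ints_cases)
    moreover have "Gamma (\<alpha> + 1 + 1) = (\<alpha> + 1) * Gamma (\<alpha> + 1)"
      using \<alpha> by (intro Gamma_plus1) (auto elim!: nonpos_Ints_cases)
    moreover have "1 \<le> Gamma (\<alpha> + 1 + 1)" using \<alpha> by (intro Gamma_ge_1) simp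
    ultimately have "1 \<le> Gamma \<alpha> / c * \<alpha>" by (simp add: c_def mult_ac add_ac)
    then show ?thesis using \<alpha> by (simp add: pos_divide_le_eq)
  qed
  finally have "Gamma \<alpha> / c * (- ml_profile_deriv \<alpha> c x) \<le> Gamma \<alpha> / c * 2" by (simp add: mult_ac)
  then have "- ml_profile_deriv \<alpha> c x \<le> 2"
    using c \<alpha> by (subst (asm) mult_le_cancel_left_pos) auto
  then show ?thesis by (simp add: c_def)
qed

lemma ml_profile_eq_profile: "ml_profile \<alpha> (1 / (1 + \<alpha>)) = profile \<alpha>"
  by (auto simp: ml_profile_def profile_def)

text \<open>Mean value theorem: the derivative is controlled at positive points, and continuity on
  the closed half-line admits \<open>x = 0\<close>.\<close>

lemma profile_lipschitz:
  assumes "0 \<le> x" "x \<le> y"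
  shows "\<bar>profile \<alpha> y - profile \<alpha> x\<bar> \<le> 2 * (y - x)"
proof (cases "x = y")
  case False
  define c where "c = 1 / (1 + \<alpha>)"
  have c: "c > 0" using \<alpha> by (simp add: c_def)
  have "x < y" using False assms by simp
  moreover have "continuous_on {x..y} (ml_profile \<alpha> c)"
    using continuous_on_ml_profile by (rule continuous_on_subset) (use assms in auto)
  moreover have "\<And>z. x < z \<Longrightarrow> z < y \<Longrightarrow> (ml_profile \<alpha> c) differentiable (at z)"
    using DERIV_ml_profile assms by (metis le_less_trans real_differentiable_def)
  ultimately obtain l z where z: "x < z" "z < y" "DERIV (ml_profile \<alpha> c) z :> l"
    "ml_profile \<alpha> c y - ml_profile \<alpha> c x = (y - x) * l"
    using MVT[of x y "ml_profile \<alpha> c"] by blast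
  have "z > 0" using z assms by simp
  then have "l = ml_profile_deriv \<alpha> c z" using DERIV_unique[OF z(3) DERIV_ml_profile] by simp
  then have "\<bar>l\<bar> \<le> 2" using ml_profile_deriv_bound[OF \<open>z > 0\<close>] ml_profile_deriv_nonpos[OF c \<open>z > 0\<close>]
    by (simp add: c_def)
  then have "\<bar>ml_profile \<alpha> c y - ml_profile \<alpha> c x\<bar> \<le> (y - x) * 2"
    unfolding z(4) abs_mult using assms by (intro mult_mono) auto
  then show ?thesis by (simp add: ml_profile_eq_profile c_def mult.commute)
qed simp

lemmas profile_antimono = ml_profile_antimono[of "1 / (1 + \<alpha>)", unfolded ml_profile_eq_profile]
lemmas profile_nonneg = ml_profile_nonneg[of "1 / (1 + \<alpha>)", unfolded ml_profile_eq_profile]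
lemmas profile_le_1 = ml_profile_le_1[of "1 / (1 + \<alpha>)", unfolded ml_profile_eq_profile]

end

section \<open>Lower bound for the explicit constant\<close>

text \<open>The integrand has the primitive \<open>- ((1 / u - 1) powr \<alpha>) / \<alpha>\<close>,
  so the integral equals \<open>1 / \<alpha>\<close>. The first argument of the maximum then yields
  \<open>C1 \<alpha> \<ge> 2 powr (1 + \<alpha>) \<ge> 2\<close>.\<close>

lemma C1_ge_2:
  assumes \<alpha>: "0 < \<alpha>" "\<alpha> < 1"
  shows "2 \<le> C1 \<alpha>"
proof -
  let ?k = "\<lambda>u::real. 1 / (u powr (1 + \<alpha>) * (1 - u) powr (1 - \<alpha>))"
  have hi: "(?k has_integral (- ((1 / 1 - 1) powr \<alpha>) / \<alpha> - (- ((1 / (1/2) - 1) powr \<alpha>) / \<alpha>))) {1/2..1}"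
  proof (rule fundamental_theorem_of_calculus_interior)
    show "continuous_on {1/2..1} (\<lambda>u. - ((1 / u - 1) powr \<alpha>) / \<alpha>)"
    proof -
      have "continuous_on {1/2..1} (\<lambda>u. 1 / u - 1 :: real)" by (intro continuous_intros) auto
      moreover have "0 \<le> 1 / u - 1" if "u \<in> {1/2..1}" for u :: real using that by simp
      ultimately have "continuous_on {1/2..1} (\<lambda>u. (1 / u - 1 :: real) powr \<alpha>)"
        using \<alpha> by (intro continuous_on_powr' continuous_on_const) auto
      then show ?thesis using \<alpha> by (intro continuous_on_divide continuous_on_minus continuous_on_const) auto
    qed
    fix u :: real assume u: "u \<in> {1/2<..<1}"
    have "((\<lambda>u. - ((1 / u - 1) powr \<alpha>) / \<alpha>) has_real_derivative (1 / u - 1) powr (\<alpha> - 1) / u\<^sup>2) (at u)"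
      using u \<alpha> by (auto intro!: derivative_eq_intros simp: power2_eq_square field_simps)
    also have "(1 / u - 1) powr (\<alpha> - 1) / u\<^sup>2 = ?k u"
    proof -
      have "(1 / u - 1) powr (\<alpha> - 1) = (1 - u) powr (\<alpha> - 1) / u powr (\<alpha> - 1)"
        using u by (simp add: diff_divide_distrib flip: powr_divide)
      moreover have "u\<^sup>2 * u powr (\<alpha> - 1) = u powr (1 + \<alpha>)"
      proof -
        have "u\<^sup>2 = u powr 2" using u by simp
        then show ?thesis by (simp flip: powr_add)
      qed
      moreover have "(1 - u) powr (\<alpha> - 1) = 1 / (1 - u) powr (1 - \<alpha>)"
        using powr_minus_divide[of "1 - u" "1 - \<alpha>"] by simp
      ultimately show ?thesis by (simp add: mult.commute)
    qed
    finally show "((\<lambda>u. - ((1 / u - 1) powr \<alpha>) / \<alpha>) has_vector_derivative ?k u) (at u)"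
      by (simp add: has_real_derivative_iff_has_vector_derivative)
  qed simp
  then have hi: "(?k has_integral 1 / \<alpha>) {1/2..1}" by simp
  have "?k absolutely_integrable_on {1/2..1}"
    using hi by (intro nonnegative_absolutely_integrable_1) auto
  moreover have "(\<lambda>u. indicat_real {1/2..1} u *\<^sub>R ?k u) \<in> borel_measurable borel" by measurable
  ultimately have "set_integrable lborel {1/2..1} ?k"
    unfolding set_integrable_def by (simp add: integrable_completion)
  from set_borel_integral_eq_integral(2)[OF this] hi
  have "(LBINT u:{1/2..1}. ?k u) = 1 / \<alpha>" by (simp add: integral_unique)
  then have "C1 \<alpha> = \<alpha> * 2 powr (1 + \<alpha>) * max (1 / \<alpha>) 2" by (simp add: C1_def)
  also have "\<dots> \<ge> \<alpha> * 2 powr (1 + \<alpha>) * (1 / \<alpha>)" using \<alpha> by (intro mult_left_mono) auto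
  finally have "2 powr (1 + \<alpha>) \<le> C1 \<alpha>" using \<alpha> by simp
  moreover have "2 powr 1 \<le> 2 powr (1 + \<alpha>)" using \<alpha> by (intro powr_mono) auto
  ultimately show ?thesis by simp
qed

subsection \<open>Norm bounds for dominated kernels\<close>

text \<open>Needed for the exchange of integrals in \<open>kernel_estimate\<close>. A countable
  cover by sets of finite \<open>lborel\<close> measure also serves the completion.\<close>

lemma sigma_finite_half_line: "sigma_finite_measure half_line"
proof (rule sigma_finite_measure_restrict_space)
  obtain A :: "real set set" where A: "countable A" "A \<subseteq> sets lborel" "\<Union> A = space lborel"
    "\<forall>a\<in>A. emeasure lborel a \<noteq> \<infinity>"
    using lborel.sigma_finite_countable by blast
  show "sigma_finite_measure (lebesgue :: real measure)"
  proof (intro sigma_finite_measure.intro exI conjI)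
    show "countable A" "A \<subseteq> sets lebesgue" "\<Union> A = space lebesgue" using A by auto
    show "\<forall>a\<in>A. emeasure lebesgue a \<noteq> \<infinity>" using A by auto
  qed
qed simp

lemma measurable_half_lineI: "f \<in> borel_measurable borel \<Longrightarrow> f \<in> borel_measurable half_line"
  by (intro measurable_restrict_space1 measurable_completion) simp

lemma integrable_half_line_iff:
  fixes f :: "real \<Rightarrow> real"
  assumes "f \<in> borel_measurable borel"
  shows "integrable half_line f \<longleftrightarrow> integrable lborel (\<lambda>x. indicat_real {0<..} x * f x)"
proof -
  have "integrable half_line f \<longleftrightarrow> integrable lebesgue (\<lambda>x. indicat_real {0<..} x * f x)"
    by (simp add: integrable_restrict_space)
  also have "\<dots> \<longleftrightarrow> integrable lborel (\<lambda>x. indicat_real {0<..} x * f x)"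
    using assms by (intro integrable_completion) measurable
  finally show ?thesis .
qed

lemma nn_integral_half_line:
  assumes "f \<in> borel_measurable borel"
  shows "(\<integral>\<^sup>+x. f x \<partial>half_line) = (\<integral>\<^sup>+x. f x * indicator {0<..} x \<partial>lborel)"
  by (simp add: nn_integral_restrict_space nn_integral_completion)

text \<open>With \<open>p = 1 / (1 - \<theta>)\<close> one has \<open>\<bar>w x\<bar> powr p \<le> P
  powr (p - 1) * \<bar>w x\<bar>\<close>. Integrating and taking the \<open>p\<close>-th root gives
  the exponents \<open>(p - 1) / p = \<theta>\<close> on \<open>P\<close> and
  \<open>1 / p = 1 - \<theta>\<close> on \<open>Q\<close>.\<close>

lemma Lp_norm_interpolation:
  assumes w: "w \<in> borel_measurable half_line"
    and P: "0 \<le> P" "\<And>x. x > 0 \<Longrightarrow> \<bar>w x\<bar> \<le> P"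
    and Q: "0 \<le> Q" "(\<integral>\<^sup>+x. ennreal \<bar>w x\<bar> \<partial>half_line) \<le> ennreal Q"
    and \<theta>: "0 < \<theta>" "\<theta> < 1"
  shows "Lp_norm (1 / (1 - \<theta>)) w \<le> ennreal (P powr \<theta> * Q powr (1 - \<theta>))"
proof -
  define p where "p = 1 / (1 - \<theta>)"
  have p: "p - 1 = \<theta> / (1 - \<theta>)" "1 / p = 1 - \<theta>" using \<theta> by (auto simp: p_def field_simps)
  have p1: "p - 1 > 0" unfolding p(1) using \<theta> by simp
  have intw: "integrable half_line (\<lambda>x. \<bar>w x\<bar>)"
    using w Q(2) by (intro integrableI_bounded) (auto intro: le_less_trans)
  have le: "\<bar>w x\<bar> powr p \<le> P powr (p - 1) * \<bar>w x\<bar>" if "x > 0" for x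
  proof -
    have "\<bar>w x\<bar> powr p = \<bar>w x\<bar> powr (p - 1) * \<bar>w x\<bar>"
      using powr_mult_base[of "\<bar>w x\<bar>" "p - 1"] by (simp add: mult.commute)
    also have "\<dots> \<le> P powr (p - 1) * \<bar>w x\<bar>"
      using P(2)[OF that] p1 by (intro mult_right_mono powr_mono2) auto
    finally show ?thesis .
  qed
  have intp: "integrable half_line (\<lambda>x. \<bar>w x\<bar> powr p)"
  proof (rule Bochner_Integration.integrable_bound)
    show "integrable half_line (\<lambda>x. P powr (p - 1) * \<bar>w x\<bar>)" using intw by simp
    show "(\<lambda>x. \<bar>w x\<bar> powr p) \<in> borel_measurable half_line" using w by measurable
    show "AE x in half_line. norm (\<bar>w x\<bar> powr p) \<le> norm (P powr (p - 1) * \<bar>w x\<bar>)"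
      using le by (intro AE_I2) (simp add: space_restrict_space)
  qed
  have "(LINT x|half_line. \<bar>w x\<bar> powr p) \<le> (LINT x|half_line. P powr (p - 1) * \<bar>w x\<bar>)"
    using intp intw le by (intro integral_mono) (auto simp: space_restrict_space)
  also have "\<dots> = P powr (p - 1) * (LINT x|half_line. \<bar>w x\<bar>)" by simp
  also have "\<dots> \<le> P powr (p - 1) * Q"
  proof (rule mult_left_mono)
    have "ennreal (LINT x|half_line. \<bar>w x\<bar>) \<le> ennreal Q"
      using Q(2) by (subst nn_integral_eq_integral[symmetric]) (auto intro: intw)
    then show "(LINT x|half_line. \<bar>w x\<bar>) \<le> Q" using Q(1) by simp
  qed simp
  finally have "(LINT x|half_line. \<bar>w x\<bar> powr p) powr (1 / p) \<le> (P powr (p - 1) * Q) powr (1 / p)"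
    using \<theta> by (intro powr_mono2) (auto simp: p(2))
  also have "\<dots> = P powr \<theta> * Q powr (1 - \<theta>)"
    using P(1) Q(1) \<theta> by (simp add: powr_mult powr_powr p)
  finally show ?thesis
    unfolding Lp_norm_def p_def[symmetric] using w intp by (simp add: ennreal_leI)
qed

section \<open>Shift differences of even decreasing Lipschitz kernels\<close>

locale even_decreasing_kernel =
  fixes f :: "real \<Rightarrow> real" and L :: real
  assumes even: "f (- x) = f x"
    and nonneg: "0 \<le> f x"
    and antimono: "0 \<le> x \<Longrightarrow> x \<le> y \<Longrightarrow> f y \<le> f x"
    and lipschitz: "\<bar>f x - f y\<bar> \<le> L * \<bar>x - y\<bar>"
    and integrable_half: "integrable half_line f"
begin

lemma L_nonneg: "0 \<le> L"
  using lipschitz[of 0 1] by simp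

lemma le_f0: "f x \<le> f 0"
  using antimono[of 0 x] antimono[of 0 "- x"] even[of x] by (cases "x \<ge> 0") auto

lemma continuous_f: "continuous_on UNIV f"
proof (rule lipschitz_on_continuous_on)
  show "L-lipschitz_on UNIV f"
    using lipschitz L_nonneg by (auto simp: lipschitz_on_def dist_real_def)
qed

lemma measurable_f [measurable]: "f \<in> borel_measurable borel"
  using continuous_f by (rule borel_measurable_continuous_onI)

definition shift_diff :: "real \<Rightarrow> real \<Rightarrow> real" where
  "shift_diff y x = \<bar>f (x - y) - f x\<bar> + \<bar>f (x + y) - f x\<bar>"

lemma shift_diff_le: "0 \<le> y \<Longrightarrow> shift_diff y x \<le> 2 * L * y"
  unfolding shift_diff_def using lipschitz[of "x - y" x] lipschitz[of "x + y" x] by simp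

lemma nn_integral_shift_diff:
  assumes y: "0 < y"
  shows "(\<integral>\<^sup>+x. ennreal (shift_diff y x) \<partial>half_line) \<le> ennreal (3 * f 0 * y)"
proof -
  define F where "F x = indicat_real {0<..} x * f x" for x
  have F: "integrable lborel F"
    using integrable_half integrable_half_line_iff[OF measurable_f] by (simp add: F_def[abs_def])
  have F': "integrable lborel (\<lambda>x. F (x + d))" "(\<integral>x. F (x + d) \<partial>lborel) = (\<integral>x. F x \<partial>lborel)" for d
    using lborel_integrable_real_affine[OF F, of 1 d] lborel_integral_real_affine[of 1 F d]
    by (simp_all add: add.commute)
  have ind: "integrable lborel (\<lambda>x. c * indicat_real {a<..b} x)"
    "(\<integral>x. c * indicat_real {a<..b} x \<partial>lborel) = c * (b - a)" if "a \<le> b" for a b c :: real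
    using that by auto
  \<comment> \<open>A majorant of the shift difference on the half-line whose integral telescopes; the indicators
    absorb the strips next to the origin where \<open>F\<close> is cut off.\<close>
  define U where "U x = (F x - F (x + y) + f 0 * indicat_real {- y<..0} x) +
     (F (x + - y) - F x + 2 * f 0 * indicat_real {0<..y} x)" for x
  \<comment> \<open>By translation invariance the integrals of \<open>F\<close> and its shifts
    cancel. Two strips of width \<open>y\<close> remain, with weights \<open>f 0\<close> and
    \<open>2 * f 0\<close>, hence the constant 3.\<close>
  have "has_bochner_integral lborel U
     (((\<integral>x. F x \<partial>lborel) - (\<integral>x. F x \<partial>lborel) + f 0 * (0 - (- y))) +
      ((\<integral>x. F x \<partial>lborel) - (\<integral>x. F x \<partial>lborel) + 2 * f 0 * (y - 0)))"
    unfolding U_def[abs_def] using y F F' ind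
    by (intro has_bochner_integral_add has_bochner_integral_diff)
       (auto simp: has_bochner_integral_iff F'[of "- y", simplified] simp del: integrable_mult_right_iff)
  then have U: "integrable lborel U" "integral\<^sup>L lborel U = 3 * f 0 * y"
    by (auto simp: has_bochner_integral_iff)
  have bound: "0 \<le> U x \<and> indicat_real {0<..} x * shift_diff y x \<le> U x" for x
  proof -
    consider "x \<le> - y" | "- y < x" "x \<le> 0" | "0 < x" "x \<le> y" | "y < x" by linarith
    then show ?thesis
    proof cases
      case 1
      then show ?thesis using y by (simp add: U_def F_def)
    next
      case 2
      then show ?thesis using y le_f0[of "x + y"] by (simp add: U_def F_def)
    next
      \<comment> \<open>Here \<open>x - y \<le> 0\<close>, so the sign of
        \<open>f (x - y) - f x\<close> is unknown; the weight \<open>2 * f 0\<close> covers both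
        signs.\<close>
      case 3
      then show ?thesis using y le_f0[of x] le_f0[of "x - y"] nonneg[of x] nonneg[of "x - y"] antimono[of x "x + y"]
        by (simp add: U_def F_def shift_diff_def abs_if)
    next
      case 4
      then show ?thesis using y antimono[of x "x + y"] antimono[of "x - y" x]
        by (simp add: U_def F_def shift_diff_def)
    qed
  qed
  have "(\<integral>\<^sup>+x. ennreal (shift_diff y x) \<partial>half_line) =
      (\<integral>\<^sup>+x. ennreal (shift_diff y x) * indicator {0<..} x \<partial>lborel)"
    by (rule nn_integral_half_line) (unfold shift_diff_def, measurable)
  also have "\<dots> \<le> (\<integral>\<^sup>+x. ennreal (U x) \<partial>lborel)"
  proof (rule nn_integral_mono)
    fix x
    show "ennreal (shift_diff y x) * indicator {0<..} x \<le> ennreal (U x)"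
      using bound[of x] by (auto simp: indicator_def ennreal_leI)
  qed
  also have "\<dots> = ennreal (3 * f 0 * y)"
    using U bound by (subst nn_integral_eq_integral) auto
  finally show ?thesis .
qed

text \<open>The supremum bound integrates \<open>shift_diff_le\<close> in \<open>y\<close> against
  \<open>\<bar>g y\<bar>\<close>. For the integral bound the order of integration is exchanged, and
  \<open>nn_integral_shift_diff\<close> is applied for each fixed \<open>y\<close>. A general
  \<open>k\<close> lets \<open>w1\<close> and the corrected \<open>w2\<close> share the
  argument.\<close>

lemma kernel_estimate:
  fixes k :: "real \<Rightarrow> real \<Rightarrow> real" and g :: "real \<Rightarrow> real"
  assumes g: "integrable half_line g" and yg: "integrable half_line (\<lambda>y. y * g y)"
    and k[measurable]: "(\<lambda>p. k (fst p) (snd p)) \<in> borel_measurable borel"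
    and k_le: "\<And>x y. 0 < x \<Longrightarrow> 0 < y \<Longrightarrow> \<bar>k x y\<bar> \<le> shift_diff y x"
  defines "N \<equiv> LINT y|half_line. y * \<bar>g y\<bar>"
    and "w \<equiv> \<lambda>x. LINT y|half_line. k x y * g y"
  shows "w \<in> borel_measurable half_line"
    and "0 < x \<Longrightarrow> \<bar>w x\<bar> \<le> 2 * L * N"
    and "(\<integral>\<^sup>+x. ennreal \<bar>w x\<bar> \<partial>half_line) \<le> ennreal (3 * f 0 * N)"
proof -
  interpret H: sigma_finite_measure half_line by (rule sigma_finite_half_line)
  interpret HH: pair_sigma_finite half_line half_line ..
  have id[measurable]: "(\<lambda>x. x) \<in> half_line \<rightarrow>\<^sub>M borel" by (rule measurable_half_lineI) simp
  have gm[measurable]: "g \<in> borel_measurable half_line" using g by simp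
  \<comment> \<open>The factors carry Lebesgue sets while \<open>k\<close> is Borel on the plane, so
    measurability on the product is pulled back along the two coordinates.\<close>
  have fm[measurable]: "fst \<in> half_line \<Otimes>\<^sub>M half_line \<rightarrow>\<^sub>M borel" "snd \<in> half_line \<Otimes>\<^sub>M half_line \<rightarrow>\<^sub>M borel"
    using measurable_compose[OF measurable_fst id] measurable_compose[OF measurable_snd id] by simp_all
  have kp[measurable]: "(\<lambda>p. k (fst p) (snd p)) \<in> borel_measurable (half_line \<Otimes>\<^sub>M half_line)"
    using measurable_compose[OF borel_measurable_Pair[OF fm] k] by simp
  have gp[measurable]: "(\<lambda>p. g (snd p)) \<in> borel_measurable (half_line \<Otimes>\<^sub>M half_line)"
    using measurable_compose[OF measurable_snd gm] .
  have kx[measurable]: "k x \<in> borel_measurable half_line" for x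
    using measurable_compose[OF measurable_half_lineI[of "\<lambda>y. y"] measurable_compose[OF _ k, of "\<lambda>y. (x, y)" borel]]
    by simp
  show "w \<in> borel_measurable half_line" unfolding w_def
    by (rule H.borel_measurable_lebesgue_integral) (use kp gp in \<open>simp add: split_beta'\<close>)
  have yg': "integrable half_line (\<lambda>y. y * \<bar>g y\<bar>)"
    using integrable_abs[OF yg] by (subst Bochner_Integration.integrable_cong[of _ _ _ "\<lambda>y. \<bar>y * g y\<bar>"])
      (auto simp: abs_mult space_restrict_space)
  have kg_le: "\<bar>k x y * g y\<bar> \<le> 2 * L * (y * \<bar>g y\<bar>)" if "0 < x" "0 < y" for x y
  proof -
    have "\<bar>k x y\<bar> * \<bar>g y\<bar> \<le> 2 * L * y * \<bar>g y\<bar>"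
      using order_trans[OF k_le[OF that] shift_diff_le[of y x]] that by (intro mult_right_mono) auto
    then show ?thesis by (simp add: abs_mult mult.assoc)
  qed
  have kg: "integrable half_line (\<lambda>y. k x y * g y)" if "0 < x" for x
  proof (rule Bochner_Integration.integrable_bound)
    show "integrable half_line (\<lambda>y. 2 * L * (y * \<bar>g y\<bar>))" using yg' by (rule integrable_mult_right)
    show "AE y in half_line. norm (k x y * g y) \<le> norm (2 * L * (y * \<bar>g y\<bar>))"
    proof (intro AE_I2)
      fix y assume "y \<in> space half_line"
      then have "0 < y" by (simp add: space_restrict_space)
      from kg_le[OF that this] show "norm (k x y * g y) \<le> norm (2 * L * (y * \<bar>g y\<bar>))" by simp
    qed
  qed measurable
  show "\<bar>w x\<bar> \<le> 2 * L * N" if "0 < x" for x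
  proof -
    have "\<bar>w x\<bar> \<le> (LINT y|half_line. \<bar>k x y * g y\<bar>)" unfolding w_def
      using integral_norm_bound[of half_line "\<lambda>y. k x y * g y"] by simp
    also have "\<dots> \<le> (LINT y|half_line. 2 * L * (y * \<bar>g y\<bar>))"
      using kg[OF that] yg' kg_le[OF that] by (intro integral_mono integrable_abs integrable_mult_right) (auto simp: space_restrict_space)
    finally show ?thesis by (simp add: N_def)
  qed
  have "(\<integral>\<^sup>+x. ennreal \<bar>w x\<bar> \<partial>half_line) \<le>
      (\<integral>\<^sup>+x. \<integral>\<^sup>+y. ennreal (\<bar>k x y\<bar> * \<bar>g y\<bar>) \<partial>half_line \<partial>half_line)"
  proof (rule nn_integral_mono)
    fix x assume "x \<in> space half_line"
    then have "0 < x" by (simp add: space_restrict_space)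
    from integral_norm_bound_ennreal[OF kg[OF this]]
    show "ennreal \<bar>w x\<bar> \<le> (\<integral>\<^sup>+y. ennreal (\<bar>k x y\<bar> * \<bar>g y\<bar>) \<partial>half_line)"
      by (simp add: w_def abs_mult)
  qed
  \<comment> \<open>Tonelli: the integrand is nonnegative, so joint measurability and
    sigma-finiteness suffice.\<close>
  also have "\<dots> = (\<integral>\<^sup>+y. \<integral>\<^sup>+x. ennreal (\<bar>k x y\<bar> * \<bar>g y\<bar>) \<partial>half_line \<partial>half_line)"
    by (rule HH.Fubini'[symmetric]) (use kp gp in \<open>simp add: split_beta'\<close>)
  also have "\<dots> \<le> (\<integral>\<^sup>+y. ennreal (3 * f 0 * (y * \<bar>g y\<bar>)) \<partial>half_line)"
  proof (rule nn_integral_mono)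
    fix y assume "y \<in> space half_line"
    then have y: "0 < y" by (simp add: space_restrict_space)
    have "(\<integral>\<^sup>+x. ennreal (\<bar>k x y\<bar> * \<bar>g y\<bar>) \<partial>half_line) \<le>
        (\<integral>\<^sup>+x. ennreal \<bar>g y\<bar> * ennreal (shift_diff y x) \<partial>half_line)"
      using k_le[OF _ y]
      by (intro nn_integral_mono)
         (auto simp: space_restrict_space mult.commute intro!: ennreal_leI mult_left_mono simp flip: ennreal_mult')
    also have "\<dots> = ennreal \<bar>g y\<bar> * (\<integral>\<^sup>+x. ennreal (shift_diff y x) \<partial>half_line)"
      by (intro nn_integral_cmult measurable_half_lineI) (unfold shift_diff_def, measurable)
    also have "\<dots> \<le> ennreal \<bar>g y\<bar> * ennreal (3 * f 0 * y)"
      by (intro mult_left_mono nn_integral_shift_diff[OF y]) simp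
    also have "\<dots> = ennreal (3 * f 0 * (y * \<bar>g y\<bar>))"
      using y nonneg[of 0] by (simp add: mult_ac flip: ennreal_mult')
    finally show "(\<integral>\<^sup>+x. ennreal (\<bar>k x y\<bar> * \<bar>g y\<bar>) \<partial>half_line) \<le> ennreal (3 * f 0 * (y * \<bar>g y\<bar>))" .
  qed
  also have "\<dots> = ennreal (3 * f 0 * N)"
  proof (subst nn_integral_eq_integral)
    show "integrable half_line (\<lambda>y. 3 * f 0 * (y * \<bar>g y\<bar>))" using yg' by (rule integrable_mult_right)
    show "AE y in half_line. 0 \<le> 3 * f 0 * (y * \<bar>g y\<bar>)"
      using nonneg[of 0] by (intro AE_I2) (simp add: space_restrict_space)
  qed (simp add: N_def)
  finally show "(\<integral>\<^sup>+x. ennreal \<bar>w x\<bar> \<partial>half_line) \<le> ennreal (3 * f 0 * N)" .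
qed

end

section \<open>The fundamental solution as a decreasing kernel\<close>

lemma a0_nonneg:
  assumes "0 < \<alpha>" "\<alpha> < 1"
  shows "0 \<le> a0 \<alpha>"
proof -
  have "0 \<le> (LINT x|half_line. profile \<alpha> x)"
    using profile_nonneg[OF assms] assms by (intro Bochner_Integration.integral_nonneg) (auto simp: space_restrict_space)
  then show ?thesis by (simp add: a0_def)
qed

lemma profile_abs_lipschitz:
  assumes "0 < \<alpha>" "\<alpha> < 1"
  shows "\<bar>profile \<alpha> \<bar>x\<bar> - profile \<alpha> \<bar>y\<bar>\<bar> \<le> 2 * \<bar>x - y\<bar>"
proof -
  have "\<bar>profile \<alpha> \<bar>x\<bar> - profile \<alpha> \<bar>y\<bar>\<bar> \<le> 2 * \<bar>\<bar>x\<bar> - \<bar>y\<bar>\<bar>"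
    using profile_lipschitz[OF assms, of "\<bar>x\<bar>" "\<bar>y\<bar>"] profile_lipschitz[OF assms, of "\<bar>y\<bar>" "\<bar>x\<bar>"]
    by (cases "\<bar>x\<bar> \<le> \<bar>y\<bar>") (auto simp: abs_minus_commute)
  also have "\<dots> \<le> 2 * \<bar>x - y\<bar>" by simp
  finally show ?thesis .
qed

lemma fund_sol_eq:
  assumes "0 < \<alpha>" "0 < t"
  shows "fund_sol \<alpha> t x = a0 \<alpha> / t powr (1 / (1 + \<alpha>)) * profile \<alpha> \<bar>x / t powr (1 / (1 + \<alpha>))\<bar>"
  using assms by (simp add: fund_sol_def powr_minus_divide)

lemma integrable_fund_sol:
  assumes \<alpha>: "0 < \<alpha>" "\<alpha> < 1" and t: "0 < t"
  shows "integrable half_line (fund_sol \<alpha> t)"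
proof (cases "integrable half_line (profile \<alpha>)")
  \<comment> \<open>The profile is integrable, but this need not be proved: otherwise \<open>a0 \<alpha> = 1 / 0 = 0\<close>.\<close>
  case False
  then have "a0 \<alpha> = 0" by (simp add: a0_def not_integrable_integral_eq)
  then have "fund_sol \<alpha> t = (\<lambda>_. 0)" by (auto simp: fund_sol_def)
  then show ?thesis by simp
next
  case True
  define \<tau> where "\<tau> = t powr (1 / (1 + \<alpha>))"
  have \<tau>: "\<tau> > 0" using t by (simp add: \<tau>_def)
  have "2-lipschitz_on UNIV (\<lambda>x. profile \<alpha> \<bar>x\<bar>)"
    using profile_abs_lipschitz[OF \<alpha>] by (auto simp: lipschitz_on_def dist_real_def)
  then have m[measurable]: "(\<lambda>x. profile \<alpha> \<bar>x\<bar>) \<in> borel_measurable borel"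
    by (intro borel_measurable_continuous_onI lipschitz_on_continuous_on)
  then have m'[measurable]: "(\<lambda>x. profile \<alpha> \<bar>x / \<tau>\<bar>) \<in> borel_measurable borel"
    by (rule measurable_compose[rotated]) measurable
  have "integrable half_line (\<lambda>x. profile \<alpha> \<bar>x\<bar>)"
    using True by (rule Bochner_Integration.integrable_cong[OF refl, THEN iffD1, rotated]) (simp add: space_restrict_space)
  then have "integrable lborel (\<lambda>x. indicat_real {0<..} x * profile \<alpha> \<bar>x\<bar>)"
    by (simp add: integrable_half_line_iff m)
  from lborel_integrable_real_affine[OF this, of "1 / \<tau>" 0]
  have "integrable lborel (\<lambda>x. indicat_real {0<..} (x / \<tau>) * profile \<alpha> \<bar>x / \<tau>\<bar>)"
    using \<tau> by simp
  moreover have "indicat_real {0<..} (x / \<tau>) = indicat_real {0<..} x" for x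
    using \<tau> by (simp add: indicator_def zero_less_divide_iff)
  ultimately have "integrable half_line (\<lambda>x. profile \<alpha> \<bar>x / \<tau>\<bar>)"
    by (simp only: integrable_half_line_iff[OF m'])
  then have "integrable half_line (\<lambda>x. a0 \<alpha> / \<tau> * profile \<alpha> \<bar>x / \<tau>\<bar>)" by (rule integrable_mult_right)
  then show ?thesis using fund_sol_eq[OF \<alpha>(1) t] by (simp add: \<tau>_def cong: Bochner_Integration.integrable_cong)
qed

text \<open>The Lipschitz constant is the product of the prefactor
  \<open>a0 \<alpha> / \<tau>\<close>, the constant 2 of the profile, and \<open>1 / \<tau>\<close>
  from rescaling the argument, where
  \<open>\<tau> * \<tau> = t powr (2 / (1 + \<alpha>))\<close>.\<close>

lemma even_decreasing_kernel_fund_sol: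
  assumes \<alpha>: "0 < \<alpha>" "\<alpha> < 1" and t: "0 < t"
  shows "even_decreasing_kernel (fund_sol \<alpha> t) (2 * a0 \<alpha> / t powr (2 / (1 + \<alpha>)))"
proof
  define \<tau> where "\<tau> = t powr (1 / (1 + \<alpha>))"
  have \<tau>: "\<tau> > 0" using t by (simp add: \<tau>_def)
  have \<tau>2: "t powr (2 / (1 + \<alpha>)) = \<tau> * \<tau>" by (simp add: \<tau>_def flip: powr_add)
  have E: "fund_sol \<alpha> t x = a0 \<alpha> / \<tau> * profile \<alpha> \<bar>x / \<tau>\<bar>" for x
    unfolding \<tau>_def by (rule fund_sol_eq[OF \<alpha>(1) t])
  have c: "0 \<le> a0 \<alpha> / \<tau>" using a0_nonneg[OF \<alpha>] \<tau> by simp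
  fix x y :: real
  show "fund_sol \<alpha> t (- x) = fund_sol \<alpha> t x" by (simp add: E)
  show "0 \<le> fund_sol \<alpha> t x" unfolding E using \<alpha> by (intro mult_nonneg_nonneg c profile_nonneg) auto
  show "fund_sol \<alpha> t y \<le> fund_sol \<alpha> t x" if "0 \<le> x" "x \<le> y"
    unfolding E using \<alpha> \<tau> that by (intro mult_left_mono c profile_antimono) (auto simp: divide_right_mono)
  have "\<bar>fund_sol \<alpha> t x - fund_sol \<alpha> t y\<bar> = a0 \<alpha> / \<tau> * \<bar>profile \<alpha> \<bar>x / \<tau>\<bar> - profile \<alpha> \<bar>y / \<tau>\<bar>\<bar>"
    unfolding E right_diff_distrib[symmetric] abs_mult by (simp only: abs_of_nonneg[OF c])
  also have "\<dots> \<le> a0 \<alpha> / \<tau> * (2 * \<bar>x / \<tau> - y / \<tau>\<bar>)"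
    by (intro mult_left_mono c profile_abs_lipschitz \<alpha>)
  also have "\<bar>x / \<tau> - y / \<tau>\<bar> = \<bar>x - y\<bar> / \<tau>"
    using \<tau> by (simp flip: diff_divide_distrib)
  finally show "\<bar>fund_sol \<alpha> t x - fund_sol \<alpha> t y\<bar> \<le> 2 * a0 \<alpha> / t powr (2 / (1 + \<alpha>)) * \<bar>x - y\<bar>"
    by (simp add: \<tau>2 mult_ac)
  show "integrable half_line (fund_sol \<alpha> t)" by (rule integrable_fund_sol[OF \<alpha> t])
qed

section \<open>Decay rates in time\<close>

text \<open>Interpolates between the supremum bound of order \<open>1 / (\<tau> * \<tau>)\<close>
  and the integral bound of order \<open>1 / \<tau>\<close>; the power of \<open>\<tau>\<close> adds
  up to \<open>2 * \<theta> + (1 - \<theta>) = 1 + \<theta>\<close>. The summand 1 makes the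
  constant strictly positive, as \<open>K1\<close> and \<open>K2\<close> must be.\<close>

lemma kernel_norm_bounds:
  fixes k :: "real \<Rightarrow> real \<Rightarrow> real" and g :: "real \<Rightarrow> real"
  assumes \<alpha>: "0 < \<alpha>" "\<alpha> < 1" and \<theta>: "0 < \<theta>" "\<theta> < 1" and t: "0 < t"
    and g: "integrable half_line g" "integrable half_line (\<lambda>y. y * g y)"
    and k: "(\<lambda>p. k (fst p) (snd p)) \<in> borel_measurable borel"
    and k_le: "\<And>x y. 0 < x \<Longrightarrow> 0 < y \<Longrightarrow> \<bar>k x y\<bar> \<le>
      \<bar>fund_sol \<alpha> t (x - y) - fund_sol \<alpha> t x\<bar> + \<bar>fund_sol \<alpha> t (x + y) - fund_sol \<alpha> t x\<bar>"
    and w: "\<And>x. w x = (LINT y|half_line. k x y * g y)"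
  shows "Lp_norm (1 / (1 - \<theta>)) w \<le> ennreal (((4 * a0 \<alpha>) powr \<theta> * (3 * a0 \<alpha>) powr (1 - \<theta>) + 1) *
      t powr (- (1 + \<theta>) / (1 + \<alpha>)) * (LINT y|half_line. y * \<bar>g y\<bar>))"
    and "Linf_norm w \<le> ennreal (C2 \<alpha> / t powr (2 / (1 + \<alpha>)) * (LINT y|half_line. y * \<bar>g y\<bar>))"
proof -
  define \<tau> where "\<tau> = t powr (1 / (1 + \<alpha>))"
  define N where "N = (LINT y|half_line. y * \<bar>g y\<bar>)"
  have \<tau>: "\<tau> > 0" using t by (simp add: \<tau>_def)
  have \<tau>2: "t powr (2 / (1 + \<alpha>)) = \<tau> * \<tau>" by (simp add: \<tau>_def flip: powr_add)
  have N: "N \<ge> 0" unfolding N_def by (intro Bochner_Integration.integral_nonneg) (auto simp: space_restrict_space)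
  have a: "a0 \<alpha> \<ge> 0" by (rule a0_nonneg[OF \<alpha>])
  interpret even_decreasing_kernel "fund_sol \<alpha> t" "2 * a0 \<alpha> / t powr (2 / (1 + \<alpha>))"
    by (rule even_decreasing_kernel_fund_sol[OF \<alpha> t])
  have w': "w = (\<lambda>x. LINT y|half_line. k x y * g y)" using w by auto
  have f0: "fund_sol \<alpha> t 0 = a0 \<alpha> / \<tau>"
    using fund_sol_eq[OF \<alpha>(1) t, of 0] ml_profile_0[OF \<alpha>, of "1 / (1 + \<alpha>)"]
    by (simp add: \<tau>_def ml_profile_eq_profile[OF \<alpha>])
  define P Q where "P = 4 * a0 \<alpha> / (\<tau> * \<tau>) * N" and "Q = 3 * a0 \<alpha> / \<tau> * N"
  note est = kernel_estimate[OF g k k_le[folded shift_diff_def], folded w' N_def]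
  have meas: "w \<in> borel_measurable half_line" using est(1) by simp
  have P: "\<bar>w x\<bar> \<le> P" if "x > 0" for x using est(2)[OF _ _ that] by (simp add: P_def \<tau>2 w)
  have Q: "(\<integral>\<^sup>+x. ennreal \<bar>w x\<bar> \<partial>half_line) \<le> ennreal Q" using est(3) by (simp add: Q_def f0 w)
  have "Lp_norm (1 / (1 - \<theta>)) w \<le> ennreal (P powr \<theta> * Q powr (1 - \<theta>))"
    using a N \<tau> by (intro Lp_norm_interpolation meas P Q \<theta>) (auto simp: P_def Q_def)
  also have "P powr \<theta> * Q powr (1 - \<theta>) \<le>
     ((4 * a0 \<alpha>) powr \<theta> * (3 * a0 \<alpha>) powr (1 - \<theta>) + 1) * t powr (- (1 + \<theta>) / (1 + \<alpha>)) * N"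
  proof -
    have "P powr \<theta> * Q powr (1 - \<theta>) = ((4 * a0 \<alpha>) powr \<theta> * (3 * a0 \<alpha>) powr (1 - \<theta>)) *
        (1 / ((\<tau> * \<tau>) powr \<theta> * \<tau> powr (1 - \<theta>))) * (N powr \<theta> * N powr (1 - \<theta>))"
      unfolding P_def Q_def using a N \<tau> by (simp add: powr_mult powr_divide)
    also have "N powr \<theta> * N powr (1 - \<theta>) = N" using N by (cases "N = 0") (auto simp flip: powr_add)
    also have "(\<tau> * \<tau>) powr \<theta> * \<tau> powr (1 - \<theta>) = \<tau> powr (1 + \<theta>)"
      using \<tau> by (simp add: powr_mult add.commute flip: powr_add)
    also have "1 / \<tau> powr (1 + \<theta>) = t powr (- (1 + \<theta>) / (1 + \<alpha>))"
    proof -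
      have "- (1 + \<theta>) / (1 + \<alpha>) = - ((1 / (1 + \<alpha>)) * (1 + \<theta>))"
        unfolding times_divide_eq_left mult_1 minus_divide_left ..
      then show ?thesis unfolding \<tau>_def powr_powr by (simp only: powr_minus_divide)
    qed
    finally show ?thesis using N by (simp add: mult_right_mono)
  qed
  finally show "Lp_norm (1 / (1 - \<theta>)) w \<le> ennreal (((4 * a0 \<alpha>) powr \<theta> * (3 * a0 \<alpha>) powr (1 - \<theta>) + 1) *
      t powr (- (1 + \<theta>) / (1 + \<alpha>)) * (LINT y|half_line. y * \<bar>g y\<bar>))"
    by (simp add: N_def ennreal_leI)
  \<comment> \<open>Here 4 is twice the Lipschitz constant 2 of the profile, one 2 for each shift;
    \<open>C1_ge_2\<close> then compares it with
    \<open>C2 \<alpha> = 2 * a0 \<alpha> * C1 \<alpha>\<close>.\<close>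
  have "4 * a0 \<alpha> \<le> C2 \<alpha>" unfolding C2_def using mult_left_mono[OF C1_ge_2[OF \<alpha>] a] by (simp add: mult_ac)
  then have "P \<le> C2 \<alpha> / t powr (2 / (1 + \<alpha>)) * N"
    unfolding P_def \<tau>2 using \<tau> N by (intro mult_right_mono divide_right_mono) auto
  then have "AE x in half_line. ennreal \<bar>w x\<bar> \<le> ennreal (C2 \<alpha> / t powr (2 / (1 + \<alpha>)) * N)"
    using P by (intro AE_I2 ennreal_leI) (auto simp: space_restrict_space intro: order_trans)
  moreover have "(\<lambda>x. ennreal \<bar>w x\<bar>) \<in> borel_measurable half_line" using meas by measurable
  ultimately show "Linf_norm w \<le> ennreal (C2 \<alpha> / t powr (2 / (1 + \<alpha>)) * (LINT y|half_line. y * \<bar>g y\<bar>))"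
    unfolding Linf_norm_def N_def using meas by (simp add: esssup_I)
qed

theorem theorem1:
  fixes \<alpha> \<theta> m :: real and g :: "real \<Rightarrow> real"
  assumes "0 < \<alpha>" "\<alpha> < 1"
    and "integrable half_line g" "integrable half_line (\<lambda>y. y * g y)"
    and "compactly_supported g" "compactly_supported (\<lambda>y. y * g y)"
    and "0 < \<theta>" "\<theta> < 1"
    and "m = (LINT y|half_line. g y)"
  shows "(\<exists>K1>0. \<forall>t>1.
           Lp_norm (1 / (1 - \<theta>)) (\<lambda>x. w1 \<alpha> g x t)
             \<le> ennreal (K1 * t powr (- (1 + \<theta>) / (1 + \<alpha>)) * (LINT y|half_line. y * \<bar>g y\<bar>))) \<and>
         (\<exists>K2>0. \<forall>t>1.
           Lp_norm (1 / (1 - \<theta>)) (\<lambda>x. w2 \<alpha> g x t - 2 * m * fund_sol \<alpha> t x)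
             \<le> ennreal (K2 * t powr (- (1 + \<theta>) / (1 + \<alpha>)) * (LINT y|half_line. y * \<bar>g y\<bar>))) \<and>
         (\<forall>t>1.
           Linf_norm (\<lambda>x. w2 \<alpha> g x t - 2 * m * fund_sol \<alpha> t x)
             \<le> ennreal (C2 \<alpha> / t powr (2 / (1 + \<alpha>)) * (LINT y|half_line. y * \<bar>g y\<bar>)) \<and>
           Linf_norm (\<lambda>x. w1 \<alpha> g x t)
             \<le> ennreal (C2 \<alpha> / t powr (2 / (1 + \<alpha>)) * (LINT y|half_line. y * \<bar>g y\<bar>)))"
proof -
  let ?K = "(4 * a0 \<alpha>) powr \<theta> * (3 * a0 \<alpha>) powr (1 - \<theta>) + 1"
  have K: "?K > 0" by (simp add: add_nonneg_pos)
  have w1_bounds: "Lp_norm (1 / (1 - \<theta>)) (\<lambda>x. w1 \<alpha> g x t)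
        \<le> ennreal (?K * t powr (- (1 + \<theta>) / (1 + \<alpha>)) * (LINT y|half_line. y * \<bar>g y\<bar>))"
      "Linf_norm (\<lambda>x. w1 \<alpha> g x t)
        \<le> ennreal (C2 \<alpha> / t powr (2 / (1 + \<alpha>)) * (LINT y|half_line. y * \<bar>g y\<bar>))" if "t > 1" for t
  proof -
    interpret even_decreasing_kernel "fund_sol \<alpha> t" "2 * a0 \<alpha> / t powr (2 / (1 + \<alpha>))"
      using assms that by (intro even_decreasing_kernel_fund_sol) auto
    \<comment> \<open>Inserting \<open>fund_sol \<alpha> t x\<close> and the triangle inequality
      bound this kernel by the sum of the two shift differences.\<close>
    define k where "k x y = fund_sol \<alpha> t (x - y) - fund_sol \<alpha> t (x + y)" for x y
    have "(\<lambda>p. k (fst p) (snd p)) \<in> borel_measurable borel" unfolding k_def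
      by (intro borel_measurable_diff borel_measurable_continuous_onI continuous_on_compose2[OF continuous_f] continuous_intros) auto
    note * = kernel_norm_bounds[OF assms(1,2,7,8) _ assms(3,4) this, of t "\<lambda>x. w1 \<alpha> g x t"]
    show "Lp_norm (1 / (1 - \<theta>)) (\<lambda>x. w1 \<alpha> g x t)
        \<le> ennreal (?K * t powr (- (1 + \<theta>) / (1 + \<alpha>)) * (LINT y|half_line. y * \<bar>g y\<bar>))"
      by (rule *(1)) (use that in \<open>auto simp: k_def w1_def\<close>)
    show "Linf_norm (\<lambda>x. w1 \<alpha> g x t)
        \<le> ennreal (C2 \<alpha> / t powr (2 / (1 + \<alpha>)) * (LINT y|half_line. y * \<bar>g y\<bar>))"
      by (rule *(2)) (use that in \<open>auto simp: k_def w1_def\<close>)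
  qed
  have w2_bounds: "Lp_norm (1 / (1 - \<theta>)) (\<lambda>x. w2 \<alpha> g x t - 2 * m * fund_sol \<alpha> t x)
        \<le> ennreal (?K * t powr (- (1 + \<theta>) / (1 + \<alpha>)) * (LINT y|half_line. y * \<bar>g y\<bar>))"
      "Linf_norm (\<lambda>x. w2 \<alpha> g x t - 2 * m * fund_sol \<alpha> t x)
        \<le> ennreal (C2 \<alpha> / t powr (2 / (1 + \<alpha>)) * (LINT y|half_line. y * \<bar>g y\<bar>))" if "t > 1" for t
  proof -
    interpret even_decreasing_kernel "fund_sol \<alpha> t" "2 * a0 \<alpha> / t powr (2 / (1 + \<alpha>))"
      using assms that by (intro even_decreasing_kernel_fund_sol) auto
    define k where "k x y = fund_sol \<alpha> t (x - y) + fund_sol \<alpha> t (x + y) - 2 * fund_sol \<alpha> t x" for x y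
    have km: "(\<lambda>p. k (fst p) (snd p)) \<in> borel_measurable borel" unfolding k_def
      by (intro borel_measurable_diff borel_measurable_add borel_measurable_times borel_measurable_const
        borel_measurable_continuous_onI continuous_on_compose2[OF continuous_f] continuous_intros) auto
    \<comment> \<open>Since \<open>m\<close> is the integral of \<open>g\<close>, the subtracted
      term moves under the integral and leaves a symmetric second difference. Splitting the integral
      is justified by the integrable bound
      \<open>2 * fund_sol \<alpha> t 0 * \<bar>g y\<bar>\<close>.\<close>
    have w2: "w2 \<alpha> g x t - 2 * m * fund_sol \<alpha> t x = (LINT y|half_line. k x y * g y)" for x
    proof -
      have "integrable half_line (\<lambda>y. (fund_sol \<alpha> t (x - y) + fund_sol \<alpha> t (x + y)) * g y)"
      proof (rule Bochner_Integration.integrable_bound)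
        show "integrable half_line (\<lambda>y. 2 * fund_sol \<alpha> t 0 * g y)"
          using assms(3) by (rule integrable_mult_right)
        have "(\<lambda>y. fund_sol \<alpha> t (x - y) + fund_sol \<alpha> t (x + y)) \<in> borel_measurable half_line"
          by (rule measurable_half_lineI) measurable
        then show "(\<lambda>y. (fund_sol \<alpha> t (x - y) + fund_sol \<alpha> t (x + y)) * g y) \<in> borel_measurable half_line"
          using assms(3) by (intro borel_measurable_times) auto
        show "AE y in half_line. norm ((fund_sol \<alpha> t (x - y) + fund_sol \<alpha> t (x + y)) * g y)
            \<le> norm (2 * fund_sol \<alpha> t 0 * g y)"
        proof (intro AE_I2)
          fix y
          have "\<bar>fund_sol \<alpha> t (x - y) + fund_sol \<alpha> t (x + y)\<bar> \<le> \<bar>2 * fund_sol \<alpha> t 0\<bar>"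
            using le_f0[of "x - y"] le_f0[of "x + y"] nonneg[of "x - y"] nonneg[of "x + y"] by simp
          then show "norm ((fund_sol \<alpha> t (x - y) + fund_sol \<alpha> t (x + y)) * g y)
            \<le> norm (2 * fund_sol \<alpha> t 0 * g y)"
            unfolding real_norm_def abs_mult[of _ "g y"] by (rule mult_right_mono) simp
        qed
      qed
      then have "(LINT y|half_line. (fund_sol \<alpha> t (x - y) + fund_sol \<alpha> t (x + y)) * g y - 2 * fund_sol \<alpha> t x * g y) =
          w2 \<alpha> g x t - 2 * fund_sol \<alpha> t x * m"
        unfolding w2_def assms(9) using assms(3)
        by (subst Bochner_Integration.integral_diff) auto
      then show ?thesis by (simp add: k_def algebra_simps)
    qed
    have k_le: "\<bar>k x y\<bar> \<le> \<bar>fund_sol \<alpha> t (x - y) - fund_sol \<alpha> t x\<bar> + \<bar>fund_sol \<alpha> t (x + y) - fund_sol \<alpha> t x\<bar>" for x y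
      by (simp add: k_def)
    note * = kernel_norm_bounds[OF assms(1,2,7,8) _ assms(3,4) km k_le w2]
    show "Lp_norm (1 / (1 - \<theta>)) (\<lambda>x. w2 \<alpha> g x t - 2 * m * fund_sol \<alpha> t x)
        \<le> ennreal (?K * t powr (- (1 + \<theta>) / (1 + \<alpha>)) * (LINT y|half_line. y * \<bar>g y\<bar>))"
      by (rule *(1)) (use that in auto)
    show "Linf_norm (\<lambda>x. w2 \<alpha> g x t - 2 * m * fund_sol \<alpha> t x)
        \<le> ennreal (C2 \<alpha> / t powr (2 / (1 + \<alpha>)) * (LINT y|half_line. y * \<bar>g y\<bar>))"
      by (rule *(2)) (use that in auto)
  qed
  show ?thesis using w1_bounds w2_bounds K by blast
qed

end
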